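(* Let $R$ be a commutative unital ring and let $C$ be a color coaugmented $R$-coalgebra colored by a set $X$. Then for every $c\in\overline{C}_{x,y}$ ($x,y\in X$), $\Delta(c)$ can be written as $x\otimes c+c\otimes y+w$ with $w\in\overline{C}\boxtimes\overline{C}$, that is, $w=\overline\Delta(c)$ (where $x,y$ are identified with $i_X(x),i_X(y)\in C$). If additionally $C=\bigoplus_{i\ge0}C_i$ is graded and color reduced (so that $\overline C$ is also graded), then moreover for $c\in\overline{C}_n$ and $n>0$, $w\in\bigoplus_{i=1}^{n-1}C_i\boxtimes C_{n-i}$.
   Context: Coalgebras are counital over $R$. For submodules $M,N\subset C$, $M\boxtimes N\subset C\otimes C$ is the submodule of finite sums of $x\otimes y$, $x\in M,y\in N$. For a set $X$, $C[X]$ is the free $R$-module on $X$ with coalgebra structure in which each $x\in X$ is grouplike ($\Delta(x)=x\otimes x$, $\epsilon(x)=1$). A coalgebra $C$ colored by $X$ is a coalgebra with a $C[X]$-bicomodule structure $\lambda:C\to C[X]\otimes C$, $\rho:C\to C\otimes C[X]$ such that $\Delta$ is a map of $C[X]$-bicomodules and $\Delta$ factors through the cotensor product of $C$ with itself over $C[X]$. Equivalently $C=\bigoplus_{(x,y)\in X\times X}C_{x,y}$, where $\lambda(c)=x\otimes c$, $\rho(c)=c\otimes y$ for $c\in C_{x,y}$, and $\Delta(C_{x,y})\subset\bigoplus_zC_{x,z}\boxtimes C_{z,y}$. It is color counital if there is a map $\epsilon_X:C\to C[X]$ of coalgebras and of $C[X]$-bicomodules with $(\epsilon_X\otimes\mathrm{id})\Delta=\lambda$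 and $(\mathrm{id}\otimes\epsilon_X)\Delta=\rho$; color coaugmented if in addition there is a coalgebra map of $C[X]$-bicomodules $i_X:C[X]\to C$ with $\epsilon_Xi_X=\mathrm{id}$. Then $C=i_X(C[X])\oplus\overline C$ with $\overline C=\ker\epsilon_X=\bigoplus_{(x,y)}\overline C_{x,y}$, where $\overline C_{x,y}=C_{x,y}$ for $x\ne y$ and $C_{x,x}=Ri_X(x)\oplus\overline C_{x,x}$. The reduced diagonal is $\overline\Delta=\Delta-(i_X\otimes\mathrm{id})\lambda-(\mathrm{id}\otimes i_X)\rho$. A graded (by $\mathbb N$) color coaugmented coalgebra colored by $X$ is color reduced if $C_0=i_X(C[X])$. *)

theory Defs
  imports "HOL-Algebra.Module" "HOL-Algebra.AbelCoset"
begin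

section \<open>Linear maps, sums of submodules, free and quotient modules\<close>

definition linear_hom ::
  "('r, 'e) ring_scheme \<Rightarrow> ('r, 'a, 'm) module_scheme \<Rightarrow> ('r, 'b, 'n) module_scheme \<Rightarrow> ('a \<Rightarrow> 'b) set"
  where "linear_hom R M N =
    {h \<in> carrier M \<rightarrow> carrier N.
      (\<forall>x\<in>carrier M. \<forall>y\<in>carrier M. h (x \<oplus>\<^bsub>M\<^esub> y) = h x \<oplus>\<^bsub>N\<^esub> h y) \<and>
      (\<forall>r\<in>carrier R. \<forall>x\<in>carrier M. h (r \<odot>\<^bsub>M\<^esub> x) = r \<odot>\<^bsub>N\<^esub> h x)}"

definition submodule_span ::
  "('r, 'e) ring_scheme \<Rightarrow> ('r, 'a, 'm) module_scheme \<Rightarrow> 'a set \<Rightarrow> 'a set"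
  where "submodule_span R M S = \<Inter>{H. submodule H R M \<and> S \<subseteq> H}"

definition sum_family :: "('r, 'a, 'm) module_scheme \<Rightarrow> 'i set \<Rightarrow> ('i \<Rightarrow> 'a set) \<Rightarrow> 'a set"
  where "sum_family M I N = {finsum M a J | J a. finite J \<and> J \<subseteq> I \<and> a \<in> (\<Pi> j\<in>J. N j)}"

definition internal_direct_sum ::
  "('r, 'e) ring_scheme \<Rightarrow> ('r, 'a, 'm) module_scheme \<Rightarrow> 'i set \<Rightarrow> ('i \<Rightarrow> 'a set) \<Rightarrow> 'a set \<Rightarrow> bool"
  where "internal_direct_sum R M I N S \<longleftrightarrow>
    (\<forall>i\<in>I. submodule (N i) R M) \<and>
    S = sum_family M I N \<and>
    (\<forall>J a. finite J \<and> J \<subseteq> I \<and> a \<in> (\<Pi> j\<in>J. N j) \<and> finsum M a J = \<zero>\<^bsub>M\<^esub>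
       \<longrightarrow> (\<forall>j\<in>J. a j = \<zero>\<^bsub>M\<^esub>))"

text \<open>
  The record type of modules extends that of rings, but the locale \<open>module\<close> puts no condition on
  the fields \<open>mult\<close> and \<open>one\<close> of the module; they are left undefined below.
\<close>

definition ring_module :: "('r, 'e) ring_scheme \<Rightarrow> ('r, 'r) module"
  where "ring_module R =
    \<lparr>carrier = carrier R, mult = undefined, one = undefined,
     zero = \<zero>\<^bsub>R\<^esub>, add = (\<oplus>\<^bsub>R\<^esub>), smult = (\<otimes>\<^bsub>R\<^esub>)\<rparr>"

definition free_module :: "('r, 'e) ring_scheme \<Rightarrow> 'x set \<Rightarrow> ('r, 'x \<Rightarrow> 'r) module"
  where "free_module R X =
    \<lparr>carrier = {f. (\<forall>x. f x \<in> carrier R) \<and> (\<forall>x. x \<notin> X \<longrightarrow> f x = \<zero>\<^bsub>R\<^esub>) \<and> finite {x. f x \<noteq> \<zero>\<^bsub>R\<^esub>}},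
     mult = undefined, one = undefined,
     zero = (\<lambda>x. \<zero>\<^bsub>R\<^esub>), add = (\<lambda>f g x. f x \<oplus>\<^bsub>R\<^esub> g x), smult = (\<lambda>r f x. r \<otimes>\<^bsub>R\<^esub> f x)\<rparr>"

definition basis_elem :: "('r, 'e) ring_scheme \<Rightarrow> 'x \<Rightarrow> 'x \<Rightarrow> 'r"
  where "basis_elem R x = (\<lambda>y. if y = x then \<one>\<^bsub>R\<^esub> else \<zero>\<^bsub>R\<^esub>)"

definition quotient_module :: "('r, 'a, 'm) module_scheme \<Rightarrow> 'a set \<Rightarrow> ('r, 'a set) module"
  where "quotient_module M H =
    \<lparr>carrier = a_rcosets\<^bsub>M\<^esub> H, mult = undefined, one = undefined,
     zero = H, add = (\<lambda>A B. A <+>\<^bsub>M\<^esub> B), smult = (\<lambda>r A. \<Union>a\<in>A. H +>\<^bsub>M\<^esub> (r \<odot>\<^bsub>M\<^esub> a))\<rparr>"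

section \<open>Tensor products\<close>

definition tensor_relators ::
  "('r, 'e) ring_scheme \<Rightarrow> ('r, 'a, 'm) module_scheme \<Rightarrow> ('r, 'b, 'n) module_scheme \<Rightarrow> ('a \<times> 'b \<Rightarrow> 'r) set"
  where "tensor_relators R M N =
    (let F = free_module R (carrier M \<times> carrier N); e = basis_elem R in
      {e (m \<oplus>\<^bsub>M\<^esub> m', n) \<ominus>\<^bsub>F\<^esub> (e (m, n) \<oplus>\<^bsub>F\<^esub> e (m', n)) | m m' n.
         m \<in> carrier M \<and> m' \<in> carrier M \<and> n \<in> carrier N} \<union>
      {e (m, n \<oplus>\<^bsub>N\<^esub> n') \<ominus>\<^bsub>F\<^esub> (e (m, n) \<oplus>\<^bsub>F\<^esub> e (m, n')) | m n n'.
         m \<in> carrier M \<and> n \<in> carrier N \<and> n' \<in> carrier N} \<union>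
      {e (r \<odot>\<^bsub>M\<^esub> m, n) \<ominus>\<^bsub>F\<^esub> (r \<odot>\<^bsub>F\<^esub> e (m, n)) | r m n.
         r \<in> carrier R \<and> m \<in> carrier M \<and> n \<in> carrier N} \<union>
      {e (m, r \<odot>\<^bsub>N\<^esub> n) \<ominus>\<^bsub>F\<^esub> (r \<odot>\<^bsub>F\<^esub> e (m, n)) | r m n.
         r \<in> carrier R \<and> m \<in> carrier M \<and> n \<in> carrier N})"

definition tensor_kernel ::
  "('r, 'e) ring_scheme \<Rightarrow> ('r, 'a, 'm) module_scheme \<Rightarrow> ('r, 'b, 'n) module_scheme \<Rightarrow> ('a \<times> 'b \<Rightarrow> 'r) set"
  where "tensor_kernel R M N =
    submodule_span R (free_module R (carrier M \<times> carrier N)) (tensor_relators R M N)"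

definition tensor ::
  "('r, 'e) ring_scheme \<Rightarrow> ('r, 'a, 'm) module_scheme \<Rightarrow> ('r, 'b, 'n) module_scheme
    \<Rightarrow> ('r, ('a \<times> 'b \<Rightarrow> 'r) set) module"
  where "tensor R M N =
    quotient_module (free_module R (carrier M \<times> carrier N)) (tensor_kernel R M N)"

definition pure_tensor ::
  "('r, 'e) ring_scheme \<Rightarrow> ('r, 'a, 'm) module_scheme \<Rightarrow> ('r, 'b, 'n) module_scheme
    \<Rightarrow> 'a \<Rightarrow> 'b \<Rightarrow> ('a \<times> 'b \<Rightarrow> 'r) set"
  where "pure_tensor R M N m n =
    tensor_kernel R M N +>\<^bsub>free_module R (carrier M \<times> carrier N)\<^esub> basis_elem R (m, n)"

text \<open>
  The linear map out of the tensor product induced by a bilinear map \<open>b\<close>. Extensionality only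
  fixes the values off the carrier, so that the map is unique as a total function.
\<close>

definition tensor_lift ::
  "('r, 'e) ring_scheme \<Rightarrow> ('r, 'a, 'm) module_scheme \<Rightarrow> ('r, 'b, 'n) module_scheme
    \<Rightarrow> ('r, 'c, 'p) module_scheme \<Rightarrow> ('a \<Rightarrow> 'b \<Rightarrow> 'c) \<Rightarrow> ('a \<times> 'b \<Rightarrow> 'r) set \<Rightarrow> 'c"
  where "tensor_lift R M N P b =
    (THE h. h \<in> linear_hom R (tensor R M N) P \<and> h \<in> extensional (carrier (tensor R M N)) \<and>
      (\<forall>m\<in>carrier M. \<forall>n\<in>carrier N. h (pure_tensor R M N m n) = b m n))"

text \<open>\<open>tensor_map R M N M' N' f g\<close> is the map \<open>f \<otimes> g : M \<otimes> N \<rightarrow> M' \<otimes> N'\<close>.\<close>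

definition tensor_map ::
  "('r, 'e) ring_scheme \<Rightarrow> ('r, 'a, 'm) module_scheme \<Rightarrow> ('r, 'b, 'n) module_scheme
    \<Rightarrow> ('r, 'c, 'p) module_scheme \<Rightarrow> ('r, 'd, 'q) module_scheme
    \<Rightarrow> ('a \<Rightarrow> 'c) \<Rightarrow> ('b \<Rightarrow> 'd) \<Rightarrow> ('a \<times> 'b \<Rightarrow> 'r) set \<Rightarrow> ('c \<times> 'd \<Rightarrow> 'r) set"
  where "tensor_map R M N M' N' f g =
    tensor_lift R M N (tensor R M' N') (\<lambda>m n. pure_tensor R M' N' (f m) (g n))"

text \<open>The canonical isomorphisms \<open>(M \<otimes> N) \<otimes> P \<cong> M \<otimes> (N \<otimes> P)\<close>, \<open>R \<otimes> M \<cong> M\<close> and \<open>M \<otimes> R \<cong> M\<close>.\<close>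

definition tensor_assoc ::
  "('r, 'e) ring_scheme \<Rightarrow> ('r, 'a, 'm) module_scheme \<Rightarrow> ('r, 'b, 'n) module_scheme
    \<Rightarrow> ('r, 'c, 'p) module_scheme
    \<Rightarrow> (('a \<times> 'b \<Rightarrow> 'r) set \<times> 'c \<Rightarrow> 'r) set \<Rightarrow> ('a \<times> ('b \<times> 'c \<Rightarrow> 'r) set \<Rightarrow> 'r) set"
  where "tensor_assoc R M N P =
    tensor_lift R (tensor R M N) P (tensor R M (tensor R N P))
      (\<lambda>t p. tensor_lift R M N (tensor R M (tensor R N P))
        (\<lambda>m n. pure_tensor R M (tensor R N P) m (pure_tensor R N P n p)) t)"

definition tensor_assoc_inv ::
  "('r, 'e) ring_scheme \<Rightarrow> ('r, 'a, 'm) module_scheme \<Rightarrow> ('r, 'b, 'n) module_scheme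
    \<Rightarrow> ('r, 'c, 'p) module_scheme
    \<Rightarrow> ('a \<times> ('b \<times> 'c \<Rightarrow> 'r) set \<Rightarrow> 'r) set \<Rightarrow> (('a \<times> 'b \<Rightarrow> 'r) set \<times> 'c \<Rightarrow> 'r) set"
  where "tensor_assoc_inv R M N P =
    tensor_lift R M (tensor R N P) (tensor R (tensor R M N) P)
      (\<lambda>m t. tensor_lift R N P (tensor R (tensor R M N) P)
        (\<lambda>n p. pure_tensor R (tensor R M N) P (pure_tensor R M N m n) p) t)"

definition left_unitor ::
  "('r, 'e) ring_scheme \<Rightarrow> ('r, 'a, 'm) module_scheme \<Rightarrow> ('r \<times> 'a \<Rightarrow> 'r) set \<Rightarrow> 'a"
  where "left_unitor R M = tensor_lift R (ring_module R) M M (\<lambda>r m. r \<odot>\<^bsub>M\<^esub> m)"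

definition right_unitor ::
  "('r, 'e) ring_scheme \<Rightarrow> ('r, 'a, 'm) module_scheme \<Rightarrow> ('a \<times> 'r \<Rightarrow> 'r) set \<Rightarrow> 'a"
  where "right_unitor R M = tensor_lift R M (ring_module R) M (\<lambda>m r. r \<odot>\<^bsub>M\<^esub> m)"

text \<open>For subsets \<open>A \<subseteq> M\<close> and \<open>B \<subseteq> N\<close>, \<open>boxtimes R M N A B\<close> is \<open>A \<boxtimes> B \<subseteq> M \<otimes> N\<close>.\<close>

definition boxtimes ::
  "('r, 'e) ring_scheme \<Rightarrow> ('r, 'a, 'm) module_scheme \<Rightarrow> ('r, 'b, 'n) module_scheme
    \<Rightarrow> 'a set \<Rightarrow> 'b set \<Rightarrow> ('a \<times> 'b \<Rightarrow> 'r) set set"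
  where "boxtimes R M N A B =
    {finsum (tensor R M N) (\<lambda>i. pure_tensor R M N (a i) (b i)) {..<k} | (k :: nat) a b.
       a \<in> {..<k} \<rightarrow> A \<and> b \<in> {..<k} \<rightarrow> B}"

subsection \<open>Well-definedness\<close>

text \<open>
  The tensor product is a module with the expected universal property; in particular the
  description in \<open>tensor_lift\<close> does determine a map whenever \<open>b\<close> is bilinear.
\<close>

lemma linear_homD:
  assumes "h \<in> linear_hom R M N"
  shows "x \<in> carrier M \<Longrightarrow> h x \<in> carrier N"
    "x \<in> carrier M \<Longrightarrow> y \<in> carrier M \<Longrightarrow> h (x \<oplus>\<^bsub>M\<^esub> y) = h x \<oplus>\<^bsub>N\<^esub> h y"
    "r \<in> carrier R \<Longrightarrow> x \<in> carrier M \<Longrightarrow> h (r \<odot>\<^bsub>M\<^esub> x) = r \<odot>\<^bsub>N\<^esub> h x"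
  using assms unfolding linear_hom_def by auto

lemma free_module_module:
  fixes R :: "('r,'e) ring_scheme"
  assumes "cring R"
  shows "module R (free_module R X)"
proof -
  interpret R: cring R by fact
  have fin_add: "finite {x. f x \<oplus>\<^bsub>R\<^esub> g x \<noteq> \<zero>\<^bsub>R\<^esub>}"
    if "finite {x. f x \<noteq> \<zero>\<^bsub>R\<^esub>}" "finite {x. g x \<noteq> \<zero>\<^bsub>R\<^esub>}" for f g :: "'x \<Rightarrow> 'r"
    by (rule finite_subset[OF _ finite_UnI[OF that]]) auto
  have fin_smult: "finite {x. r \<otimes>\<^bsub>R\<^esub> f x \<noteq> \<zero>\<^bsub>R\<^esub>}"
    if "finite {x. f x \<noteq> \<zero>\<^bsub>R\<^esub>}" "r \<in> carrier R" for f :: "'x \<Rightarrow> 'r" and r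
    by (rule finite_subset[OF _ that(1)]) (use that(2) in auto)
  have fin_neg: "finite {x. \<ominus>\<^bsub>R\<^esub> f x \<noteq> \<zero>\<^bsub>R\<^esub>}"
    if "finite {x. f x \<noteq> \<zero>\<^bsub>R\<^esub>}" for f :: "'x \<Rightarrow> 'r"
    by (rule finite_subset[OF _ that(1)]) auto
  show ?thesis
  proof (rule moduleI)
    show "abelian_group (free_module R X)"
    proof (rule abelian_groupI)
      fix f assume f: "f \<in> carrier (free_module R X)"
      show "\<exists>y\<in>carrier (free_module R X). y \<oplus>\<^bsub>free_module R X\<^esub> f = \<zero>\<^bsub>free_module R X\<^esub>"
        using f by (intro bexI[of _ "\<lambda>x. \<ominus>\<^bsub>R\<^esub> f x"]) (auto simp: free_module_def fin_neg R.l_neg)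
    qed (auto simp: free_module_def fin_add R.a_ac)
  qed (auto simp: free_module_def fin_smult assms R.l_distr R.r_distr R.m_assoc)
qed

lemma submodule_span_submodule:
  assumes M: "module R M" and S: "S \<subseteq> carrier M"
  shows "submodule (submodule_span R M S) R M" "S \<subseteq> submodule_span R M S"
proof -
  interpret M: module R M by fact
  show "S \<subseteq> submodule_span R M S" unfolding submodule_span_def by auto
  show "submodule (submodule_span R M S) R M"
  proof (rule M.submoduleI)
    show "submodule_span R M S \<subseteq> carrier M"
      unfolding submodule_span_def using S M.carrier_is_submodule by auto
    have z: "\<zero>\<^bsub>M\<^esub> \<in> H" if "submodule H R M" for H
      using subgroup.one_closed[OF submodule.axioms(1)[OF that]] by simp
    show "\<zero>\<^bsub>M\<^esub> \<in> submodule_span R M S"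
      unfolding submodule_span_def using z by auto
    show "\<ominus>\<^bsub>M\<^esub> a \<in> submodule_span R M S" if "a \<in> submodule_span R M S" for a
      using that M.submoduleE(3) unfolding submodule_span_def by simp
    show "a \<oplus>\<^bsub>M\<^esub> b \<in> submodule_span R M S" if "a \<in> submodule_span R M S" "b \<in> submodule_span R M S" for a b
      using that M.submoduleE(5) unfolding submodule_span_def by simp
    show "r \<odot>\<^bsub>M\<^esub> a \<in> submodule_span R M S" if "r \<in> carrier R" "a \<in> submodule_span R M S" for a r
      using that M.submoduleE(4) unfolding submodule_span_def by simp
  qed
qed

lemma quotient_module_module:
  assumes M: "module R M" and H: "submodule H R M"
  shows "module R (quotient_module M H)"
    and "(\<lambda>x. H +>\<^bsub>M\<^esub> x) \<in> linear_hom R M (quotient_module M H)"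
    and "\<And>A. A \<in> carrier (quotient_module M H) \<Longrightarrow> \<exists>x\<in>carrier M. A = H +>\<^bsub>M\<^esub> x"
    and "\<And>x. x \<in> carrier M \<Longrightarrow> x \<in> H +>\<^bsub>M\<^esub> x"
    and "\<And>x y. x \<in> carrier M \<Longrightarrow> y \<in> H +>\<^bsub>M\<^esub> x \<Longrightarrow> \<exists>h\<in>H. y = h \<oplus>\<^bsub>M\<^esub> x"
proof -
  interpret M: module R M by fact
  interpret H: abelian_subgroup H M
    by (rule abelian_subgroupI3)
       (use H M.abelian_group_axioms in \<open>auto simp: additive_subgroup_def submodule_def\<close>)
  let ?Q = "quotient_module M H"
  have sub: "H \<subseteq> carrier M" by (rule M.submoduleE[OF H])
  have add: "(H +>\<^bsub>M\<^esub> x) <+>\<^bsub>M\<^esub> (H +>\<^bsub>M\<^esub> y) = H +>\<^bsub>M\<^esub> (x \<oplus>\<^bsub>M\<^esub> y)"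
    if "x \<in> carrier M" "y \<in> carrier M" for x y
    using H.a_rcos_sum that by simp
  have self: "x \<in> H +>\<^bsub>M\<^esub> x" if "x \<in> carrier M" for x
    using H.a_rcos_self that by simp
  show "\<And>x. x \<in> carrier M \<Longrightarrow> x \<in> H +>\<^bsub>M\<^esub> x" by (rule self)
  have elem: "\<exists>h\<in>H. y = h \<oplus>\<^bsub>M\<^esub> x" if "y \<in> H +>\<^bsub>M\<^esub> x" for x y
    using that by (auto simp: a_r_coset_def')
  show "\<And>x y. x \<in> carrier M \<Longrightarrow> y \<in> H +>\<^bsub>M\<^esub> x \<Longrightarrow> \<exists>h\<in>H. y = h \<oplus>\<^bsub>M\<^esub> x" by (rule elem)
  have zero: "H +>\<^bsub>M\<^esub> \<zero>\<^bsub>M\<^esub> = H"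
    using sub by (auto simp: a_r_coset_def')
  have absorb: "H +>\<^bsub>M\<^esub> (h \<oplus>\<^bsub>M\<^esub> x) = H +>\<^bsub>M\<^esub> x" if "h \<in> H" "x \<in> carrier M" for h x
  proof -
    have "h \<oplus>\<^bsub>M\<^esub> x \<in> H +>\<^bsub>M\<^esub> x" using that by (auto simp: a_r_coset_def')
    from M.a_repr_independence[OF this that(2) submodule.axioms(1)[OF H]] show ?thesis by (rule sym)
  qed
  have smult: "(\<Union>a\<in>H +>\<^bsub>M\<^esub> x. H +>\<^bsub>M\<^esub> (r \<odot>\<^bsub>M\<^esub> a)) = H +>\<^bsub>M\<^esub> (r \<odot>\<^bsub>M\<^esub> x)"
    if "x \<in> carrier M" "r \<in> carrier R" for r x
  proof -
    have "H +>\<^bsub>M\<^esub> (r \<odot>\<^bsub>M\<^esub> a) = H +>\<^bsub>M\<^esub> (r \<odot>\<^bsub>M\<^esub> x)" if a: "a \<in> H +>\<^bsub>M\<^esub> x" for a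
    proof -
      obtain h where h: "h \<in> H" "a = h \<oplus>\<^bsub>M\<^esub> x" using elem[OF a] by auto
      have "r \<odot>\<^bsub>M\<^esub> a = r \<odot>\<^bsub>M\<^esub> h \<oplus>\<^bsub>M\<^esub> r \<odot>\<^bsub>M\<^esub> x"
        using h sub \<open>x \<in> carrier M\<close> \<open>r \<in> carrier R\<close> by (auto intro: M.smult_r_distr)
      moreover have "r \<odot>\<^bsub>M\<^esub> h \<in> H" using M.submoduleE(4)[OF H] h \<open>r \<in> carrier R\<close> by auto
      ultimately show ?thesis using absorb \<open>x \<in> carrier M\<close> \<open>r \<in> carrier R\<close> by auto
    qed
    thus ?thesis using self[OF that(1)] by blast
  qed
  have car: "carrier ?Q = (\<lambda>x. H +>\<^bsub>M\<^esub> x) ` carrier M"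
    by (auto simp: quotient_module_def A_RCOSETS_def')
  show "\<And>A. A \<in> carrier ?Q \<Longrightarrow> \<exists>x\<in>carrier M. A = H +>\<^bsub>M\<^esub> x" using car by auto
  have ops: "x \<in> carrier M \<Longrightarrow> y \<in> carrier M \<Longrightarrow> (H +>\<^bsub>M\<^esub> x) \<oplus>\<^bsub>?Q\<^esub> (H +>\<^bsub>M\<^esub> y) = H +>\<^bsub>M\<^esub> (x \<oplus>\<^bsub>M\<^esub> y)"
    "x \<in> carrier M \<Longrightarrow> r \<in> carrier R \<Longrightarrow> r \<odot>\<^bsub>?Q\<^esub> (H +>\<^bsub>M\<^esub> x) = H +>\<^bsub>M\<^esub> (r \<odot>\<^bsub>M\<^esub> x)"
    "\<zero>\<^bsub>?Q\<^esub> = H +>\<^bsub>M\<^esub> \<zero>\<^bsub>M\<^esub>" for x y r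
    by (simp_all add: quotient_module_def add smult zero)
  show "(\<lambda>x. H +>\<^bsub>M\<^esub> x) \<in> linear_hom R M ?Q"
    by (auto simp: linear_hom_def car ops)
  show "module R ?Q"
  proof (rule moduleI)
    show "abelian_group ?Q"
    proof (rule abelian_groupI)
      fix A assume "A \<in> carrier ?Q"
      then obtain x where x: "x \<in> carrier M" "A = H +>\<^bsub>M\<^esub> x" using car by auto
      thus "\<exists>y\<in>carrier ?Q. y \<oplus>\<^bsub>?Q\<^esub> A = \<zero>\<^bsub>?Q\<^esub>"
        using ops by (intro bexI[of _ "H +>\<^bsub>M\<^esub> (\<ominus>\<^bsub>M\<^esub> x)"]) (auto simp: car M.l_neg)
    qed (auto simp: car ops M.a_ac)
  qed (auto simp: car ops M.smult_l_distr M.smult_r_distr M.smult_assoc1 M.R.cring_axioms)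
qed

lemma finsum_linear:
  assumes M: "module R M" and N: "module R N" and h: "h \<in> linear_hom R M N"
    and "finite A" "a \<in> A \<rightarrow> carrier M"
  shows "h (finsum M a A) = finsum N (\<lambda>i. h (a i)) A" "h \<zero>\<^bsub>M\<^esub> = \<zero>\<^bsub>N\<^esub>"
proof -
  interpret M: module R M by fact
  interpret N: module R N by fact
  note hD = linear_homD[OF h]
  show z: "h \<zero>\<^bsub>M\<^esub> = \<zero>\<^bsub>N\<^esub>"
    using hD(3)[of "\<zero>\<^bsub>R\<^esub>" "\<zero>\<^bsub>M\<^esub>"] hD(1)[of "\<zero>\<^bsub>M\<^esub>"] by simp
  show "h (finsum M a A) = finsum N (\<lambda>i. h (a i)) A"
    using assms(4,5)
  proof induction
    case (insert x F)
    hence "finsum M a F \<in> carrier M" by (intro M.M.finsum_closed) auto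
    thus ?case using insert hD
      by (subst M.M.finsum_insert, simp, simp, simp, simp)
         (subst N.M.finsum_insert, auto simp: Pi_def)
  qed (simp add: z)
qed

lemma free_module_expand:
  fixes R :: "('r,'e) ring_scheme"
  assumes R: "cring R" and f: "f \<in> carrier (free_module R X)"
    and A: "finite A" "{x. f x \<noteq> \<zero>\<^bsub>R\<^esub>} \<subseteq> A" "A \<subseteq> X"
  shows "f = finsum (free_module R X) (\<lambda>x. f x \<odot>\<^bsub>free_module R X\<^esub> basis_elem R x) A"
proof -
  interpret R: cring R by fact
  let ?F = "free_module R X"
  interpret F: module R ?F by (rule free_module_module[OF R])
  have b: "basis_elem R x \<in> carrier ?F" if "x \<in> X" for x
  proof -
    have "finite {y. basis_elem R x y \<noteq> \<zero>\<^bsub>R\<^esub>}"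
      by (rule finite_subset[of _ "{x}"]) (auto simp: basis_elem_def)
    thus ?thesis using that by (auto simp: free_module_def basis_elem_def)
  qed
  have fx: "f x \<in> carrier R" for x using f by (auto simp: free_module_def)
  have "finsum ?F (\<lambda>x. f x \<odot>\<^bsub>?F\<^esub> basis_elem R x) B = (\<lambda>x. if x \<in> B then f x else \<zero>\<^bsub>R\<^esub>)"
    if "finite B" "B \<subseteq> X" for B
    using that
  proof induction
    case empty thus ?case by (simp, simp add: free_module_def)
  next
    case (insert x B)
    hence "(\<lambda>x. f x \<odot>\<^bsub>?F\<^esub> basis_elem R x) \<in> B \<rightarrow> carrier ?F" "f x \<odot>\<^bsub>?F\<^esub> basis_elem R x \<in> carrier ?F"
      using b fx by auto
    with insert show ?case
      by (subst F.M.finsum_insert)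
         (auto simp: fun_eq_iff, auto simp: free_module_def basis_elem_def fx)
  qed
  from this[OF A(1,3)] show ?thesis using A(2) by (simp add: fun_eq_iff) blast
qed

lemma basis_elem_closed: "cring R \<Longrightarrow> x \<in> X \<Longrightarrow> basis_elem R x \<in> carrier (free_module R X)"
proof -
  assume R: "cring R" and x: "x \<in> X"
  interpret R: cring R by fact
  have "finite {y. basis_elem R x y \<noteq> \<zero>\<^bsub>R\<^esub>}"
    by (rule finite_subset[of _ "{x}"]) (auto simp: basis_elem_def)
  thus ?thesis using x by (auto simp: free_module_def basis_elem_def)
qed

definition free_lift where
  "free_lift R P g f = finsum P (\<lambda>x. f x \<odot>\<^bsub>P\<^esub> g x) {x. f x \<noteq> \<zero>\<^bsub>R\<^esub>}"

lemma free_lift: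
  fixes R :: "('r,'e) ring_scheme"
  assumes P: "module R P" and g: "g \<in> X \<rightarrow> carrier P"
  shows "free_lift R P g \<in> linear_hom R (free_module R X) P"
    and "x \<in> X \<Longrightarrow> free_lift R P g (basis_elem R x) = g x"
proof -
  interpret P: module R P by fact
  let ?F = "free_module R X"
  interpret F: module R ?F by (rule free_module_module) (rule P.R.cring_axioms)
  have ext: "free_lift R P g f = finsum P (\<lambda>x. f x \<odot>\<^bsub>P\<^esub> g x) A"
    if "f \<in> carrier ?F" "finite A" "{x. f x \<noteq> \<zero>\<^bsub>R\<^esub>} \<subseteq> A" "A \<subseteq> X" for f A
    unfolding free_lift_def
    by (rule P.M.add.finprod_mono_neutral_cong_left)
       (use that g in \<open>auto simp: free_module_def Pi_def\<close>)
  have supp: "finite {x. f x \<noteq> \<zero>\<^bsub>R\<^esub>}" "{x. f x \<noteq> \<zero>\<^bsub>R\<^esub>} \<subseteq> X" "f x \<in> carrier R"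
    if "f \<in> carrier ?F" for f x using that by (auto simp: free_module_def)
  show "free_lift R P g \<in> linear_hom R ?F P"
    unfolding linear_hom_def
  proof (intro CollectI conjI ballI funcsetI)
    fix f assume f: "f \<in> carrier ?F"
    show "free_lift R P g f \<in> carrier P"
      unfolding free_lift_def using supp[OF f] g by (intro P.M.finsum_closed) auto
    fix f' assume f': "f' \<in> carrier ?F"
    let ?A = "{x. f x \<noteq> \<zero>\<^bsub>R\<^esub>} \<union> {x. f' x \<noteq> \<zero>\<^bsub>R\<^esub>}"
    have A: "finite ?A" "?A \<subseteq> X" using supp[OF f] supp[OF f'] by auto
    have "finsum P (\<lambda>x. (f \<oplus>\<^bsub>?F\<^esub> f') x \<odot>\<^bsub>P\<^esub> g x) ?A
        = finsum P (\<lambda>x. f x \<odot>\<^bsub>P\<^esub> g x \<oplus>\<^bsub>P\<^esub> f' x \<odot>\<^bsub>P\<^esub> g x) ?A"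
      by (rule P.M.finsum_cong')
         (use A supp[OF f] supp[OF f'] g in \<open>auto simp: free_module_def P.smult_l_distr Pi_def\<close>)
    also have "\<dots> = finsum P (\<lambda>x. f x \<odot>\<^bsub>P\<^esub> g x) ?A \<oplus>\<^bsub>P\<^esub> finsum P (\<lambda>x. f' x \<odot>\<^bsub>P\<^esub> g x) ?A"
      by (rule P.M.finsum_addf) (use A supp[OF f] supp[OF f'] g in \<open>auto simp: Pi_def\<close>)
    finally have eq: "finsum P (\<lambda>x. (f \<oplus>\<^bsub>?F\<^esub> f') x \<odot>\<^bsub>P\<^esub> g x) ?A = \<dots>" .
    have "{x. (f \<oplus>\<^bsub>?F\<^esub> f') x \<noteq> \<zero>\<^bsub>R\<^esub>} \<subseteq> ?A" by (auto simp: free_module_def)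
    thus "free_lift R P g (f \<oplus>\<^bsub>?F\<^esub> f') = free_lift R P g f \<oplus>\<^bsub>P\<^esub> free_lift R P g f'"
      using ext[of "f \<oplus>\<^bsub>?F\<^esub> f'" ?A] ext[of f ?A] ext[of f' ?A] A eq f f' by auto
  next
    fix r f assume r: "r \<in> carrier R" and f: "f \<in> carrier ?F"
    let ?A = "{x. f x \<noteq> \<zero>\<^bsub>R\<^esub>}"
    have "finsum P (\<lambda>x. (r \<odot>\<^bsub>?F\<^esub> f) x \<odot>\<^bsub>P\<^esub> g x) ?A = finsum P (\<lambda>x. r \<odot>\<^bsub>P\<^esub> (f x \<odot>\<^bsub>P\<^esub> g x)) ?A"
      by (rule P.M.finsum_cong')
         (use supp[OF f] r g in \<open>auto simp: free_module_def P.smult_assoc1 Pi_def subset_iff\<close>)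
    also have "\<dots> = r \<odot>\<^bsub>P\<^esub> finsum P (\<lambda>x. f x \<odot>\<^bsub>P\<^esub> g x) ?A"
      by (rule P.finsum_smult_ldistr[symmetric]) (use supp[OF f] r g in \<open>auto simp: Pi_def\<close>)
    finally have eq: "finsum P (\<lambda>x. (r \<odot>\<^bsub>?F\<^esub> f) x \<odot>\<^bsub>P\<^esub> g x) ?A = \<dots>" .
    have "{x. (r \<odot>\<^bsub>?F\<^esub> f) x \<noteq> \<zero>\<^bsub>R\<^esub>} \<subseteq> ?A" using r by (auto simp: free_module_def)
    thus "free_lift R P g (r \<odot>\<^bsub>?F\<^esub> f) = r \<odot>\<^bsub>P\<^esub> free_lift R P g f"
      using ext[of "r \<odot>\<^bsub>?F\<^esub> f" ?A] ext[of f ?A] supp[OF f] eq f r by auto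
  qed
  assume x: "x \<in> X"
  have gx: "g x \<in> carrier P" using x g by auto
  have "free_lift R P g (basis_elem R x) = finsum P (\<lambda>y. basis_elem R x y \<odot>\<^bsub>P\<^esub> g y) {x}"
    by (rule ext[OF basis_elem_closed[OF P.R.cring_axioms x]]) (use x in \<open>auto simp: basis_elem_def\<close>)
  also have "\<dots> = g x" using gx by (simp add: basis_elem_def)
  finally show "free_lift R P g (basis_elem R x) = g x" .
qed

lemma kernel_submodule:
  assumes M: "module R M" and N: "module R N" and h: "h \<in> linear_hom R M N"
  shows "submodule {x \<in> carrier M. h x = \<zero>\<^bsub>N\<^esub>} R M"
proof -
  interpret M: module R M by fact
  interpret N: module R N by fact
  note hD = linear_homD[OF h]
  have z: "h \<zero>\<^bsub>M\<^esub> = \<zero>\<^bsub>N\<^esub>" by (rule finsum_linear(2)[OF M N h, of "{}"]) auto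
  show ?thesis
  proof (rule M.submoduleI)
    fix a assume a: "a \<in> {x \<in> carrier M. h x = \<zero>\<^bsub>N\<^esub>}"
    have "h (\<ominus>\<^bsub>M\<^esub> a) = h (\<ominus>\<^bsub>M\<^esub> a) \<oplus>\<^bsub>N\<^esub> h a" using a hD(1)[of "\<ominus>\<^bsub>M\<^esub> a"] by auto
    also have "\<dots> = \<zero>\<^bsub>N\<^esub>" using a hD(2)[of "\<ominus>\<^bsub>M\<^esub> a" a] z by (auto simp: M.M.l_neg)
    finally show "\<ominus>\<^bsub>M\<^esub> a \<in> {x \<in> carrier M. h x = \<zero>\<^bsub>N\<^esub>}" using a by auto
  qed (auto simp: z hD)
qed

lemma linear_minus:
  assumes M: "module R M" and N: "module R N" and h: "h \<in> linear_hom R M N"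
    and a: "a \<in> carrier M" and b: "b \<in> carrier M"
  shows "h (a \<ominus>\<^bsub>M\<^esub> b) = h a \<ominus>\<^bsub>N\<^esub> h b"
proof -
  interpret M: module R M by fact
  interpret N: module R N by fact
  note hD = linear_homD[OF h]
  have "h a = h (a \<ominus>\<^bsub>M\<^esub> b) \<oplus>\<^bsub>N\<^esub> h b"
    using a b hD(2)[of "a \<ominus>\<^bsub>M\<^esub> b" b] by (simp add: a_minus_def M.M.a_assoc M.M.l_neg)
  thus ?thesis using hD(1) a b
    by (simp add: a_minus_def N.M.a_assoc N.M.r_neg)
qed

lemma tensor_kernel_submodule:
  assumes M: "module R M" and N: "module R N"
  shows "tensor_relators R M N \<subseteq> carrier (free_module R (carrier M \<times> carrier N))"
    "submodule (tensor_kernel R M N) R (free_module R (carrier M \<times> carrier N))"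
    "tensor_relators R M N \<subseteq> tensor_kernel R M N"
proof -
  interpret M: module R M by fact
  interpret N: module R N by fact
  note R = M.R.cring_axioms
  let ?F = "free_module R (carrier M \<times> carrier N)"
  interpret F: module R ?F by (rule free_module_module[OF R])
  show 1: "tensor_relators R M N \<subseteq> carrier ?F"
    unfolding tensor_relators_def Let_def
    by (auto intro!: F.M.minus_closed F.M.a_closed F.smult_closed basis_elem_closed[OF R])
  show "submodule (tensor_kernel R M N) R ?F" "tensor_relators R M N \<subseteq> tensor_kernel R M N"
    unfolding tensor_kernel_def
    by (rule submodule_span_submodule[OF F.module_axioms 1])+
qed

lemma tensor_module:
  assumes M: "module R M" and N: "module R N"
  shows "module R (tensor R M N)"
proof -
  interpret M: module R M by fact
  show ?thesis unfolding tensor_def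
    by (rule quotient_module_module(1)[OF free_module_module[OF M.R.cring_axioms] tensor_kernel_submodule(2)[OF M N]])
qed

lemma tensor_hom_unique:
  assumes M: "module R M" and N: "module R N" and P: "module R P"
    and h: "h \<in> linear_hom R (tensor R M N) P" and h': "h' \<in> linear_hom R (tensor R M N) P"
    and eq: "\<And>m n. m \<in> carrier M \<Longrightarrow> n \<in> carrier N \<Longrightarrow> h (pure_tensor R M N m n) = h' (pure_tensor R M N m n)"
    and t: "t \<in> carrier (tensor R M N)"
  shows "h t = h' t"
proof -
  interpret M: module R M by fact
  interpret N: module R N by fact
  interpret P: module R P by fact
  note R = M.R.cring_axioms
  let ?X = "carrier M \<times> carrier N"
  let ?F = "free_module R ?X"
  let ?T = "tensor R M N"
  let ?K = "tensor_kernel R M N"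
  interpret F: module R ?F by (rule free_module_module[OF R])
  interpret T: module R ?T by (rule tensor_module[OF M N])
  note K = tensor_kernel_submodule(2)[OF M N]
  note Q = quotient_module_module[OF F.module_axioms K, folded tensor_def]
  obtain f where f: "f \<in> carrier ?F" "t = ?K +>\<^bsub>?F\<^esub> f" using Q(3)[OF t] by auto
  let ?A = "{x. f x \<noteq> \<zero>\<^bsub>R\<^esub>}"
  have A: "finite ?A" "?A \<subseteq> ?X" and fx: "\<And>x. f x \<in> carrier R"
    using f by (auto simp: free_module_def)
  have b: "basis_elem R x \<in> carrier ?F" if "x \<in> ?A" for x
    using A that by (intro basis_elem_closed[OF R]) auto
  have bX: "\<exists>m n. x = (m, n) \<and> m \<in> carrier M \<and> n \<in> carrier N" if "x \<in> ?A" for x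
    using A(2) that by auto
  have fe: "f = finsum ?F (\<lambda>x. f x \<odot>\<^bsub>?F\<^esub> basis_elem R x) ?A"
    by (rule free_module_expand[OF R f(1) A(1) _ A(2)]) auto
  have "?K +>\<^bsub>?F\<^esub> finsum ?F (\<lambda>x. f x \<odot>\<^bsub>?F\<^esub> basis_elem R x) ?A
      = finsum ?T (\<lambda>x. ?K +>\<^bsub>?F\<^esub> (f x \<odot>\<^bsub>?F\<^esub> basis_elem R x)) ?A"
    by (rule finsum_linear(1)[OF F.module_axioms T.module_axioms Q(2) A(1)]) (use b fx in auto)
  also have "\<dots> = finsum ?T (\<lambda>x. f x \<odot>\<^bsub>?T\<^esub> (?K +>\<^bsub>?F\<^esub> basis_elem R x)) ?A"
    by (rule T.M.finsum_cong')
       (use b fx linear_homD[OF Q(2)] in auto)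
  finally have te: "t = finsum ?T (\<lambda>x. f x \<odot>\<^bsub>?T\<^esub> (?K +>\<^bsub>?F\<^esub> basis_elem R x)) ?A"
    using fe f(2) by simp
  have cl: "?K +>\<^bsub>?F\<^esub> basis_elem R x \<in> carrier ?T" if "x \<in> ?A" for x
    using linear_homD(1)[OF Q(2)] b that by auto
  have *: "k t = finsum P (\<lambda>x. f x \<odot>\<^bsub>P\<^esub> k (?K +>\<^bsub>?F\<^esub> basis_elem R x)) ?A"
    if k: "k \<in> linear_hom R ?T P" for k
  proof -
    have "k t = finsum P (\<lambda>x. k (f x \<odot>\<^bsub>?T\<^esub> (?K +>\<^bsub>?F\<^esub> basis_elem R x))) ?A"
      unfolding te
      by (rule finsum_linear(1)[OF T.module_axioms P k A(1)]) (use cl fx in auto)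
    also have "\<dots> = finsum P (\<lambda>x. f x \<odot>\<^bsub>P\<^esub> k (?K +>\<^bsub>?F\<^esub> basis_elem R x)) ?A"
      by (rule P.M.finsum_cong') (use cl fx linear_homD[OF k] in auto)
    finally show ?thesis .
  qed
  show ?thesis unfolding *[OF h] *[OF h']
  proof (rule P.M.finsum_cong')
    fix x assume x: "x \<in> ?A"
    then obtain m n where "x = (m, n)" "m \<in> carrier M" "n \<in> carrier N" using bX by blast
    thus "f x \<odot>\<^bsub>P\<^esub> h (?K +>\<^bsub>?F\<^esub> basis_elem R x) = f x \<odot>\<^bsub>P\<^esub> h' (?K +>\<^bsub>?F\<^esub> basis_elem R x)"
      using eq[of m n] by (simp add: pure_tensor_def)
  qed (use cl fx linear_homD(1)[OF h'] in auto)
qed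

lemma tensor_lift:
  assumes M: "module R M" and N: "module R N" and P: "module R P"
    and cl: "\<And>m n. m \<in> carrier M \<Longrightarrow> n \<in> carrier N \<Longrightarrow> b m n \<in> carrier P"
    and addl: "\<And>m m' n. m \<in> carrier M \<Longrightarrow> m' \<in> carrier M \<Longrightarrow> n \<in> carrier N \<Longrightarrow> b (m \<oplus>\<^bsub>M\<^esub> m') n = b m n \<oplus>\<^bsub>P\<^esub> b m' n"
    and addr: "\<And>m n n'. m \<in> carrier M \<Longrightarrow> n \<in> carrier N \<Longrightarrow> n' \<in> carrier N \<Longrightarrow> b m (n \<oplus>\<^bsub>N\<^esub> n') = b m n \<oplus>\<^bsub>P\<^esub> b m n'"
    and sml: "\<And>r m n. r \<in> carrier R \<Longrightarrow> m \<in> carrier M \<Longrightarrow> n \<in> carrier N \<Longrightarrow> b (r \<odot>\<^bsub>M\<^esub> m) n = r \<odot>\<^bsub>P\<^esub> b m n"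
    and smr: "\<And>r m n. r \<in> carrier R \<Longrightarrow> m \<in> carrier M \<Longrightarrow> n \<in> carrier N \<Longrightarrow> b m (r \<odot>\<^bsub>N\<^esub> n) = r \<odot>\<^bsub>P\<^esub> b m n"
  shows "tensor_lift R M N P b \<in> linear_hom R (tensor R M N) P"
    and "\<And>m n. m \<in> carrier M \<Longrightarrow> n \<in> carrier N \<Longrightarrow> tensor_lift R M N P b (pure_tensor R M N m n) = b m n"
proof -
  interpret M: module R M by fact
  interpret N: module R N by fact
  interpret P: module R P by fact
  note R = M.R.cring_axioms
  let ?X = "carrier M \<times> carrier N"
  let ?F = "free_module R ?X"
  let ?T = "tensor R M N"
  let ?K = "tensor_kernel R M N"
  interpret F: module R ?F by (rule free_module_module[OF R])
  interpret T: module R ?T by (rule tensor_module[OF M N])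
  note K = tensor_kernel_submodule(2)[OF M N]
  note Q = quotient_module_module[OF F.module_axioms K, folded tensor_def]
  let ?g = "\<lambda>(m, n). b m n"
  define k where "k = free_lift R P ?g"
  have g: "?g \<in> ?X \<rightarrow> carrier P" using cl by auto
  have k: "k \<in> linear_hom R ?F P" and kb: "\<And>m n. m \<in> carrier M \<Longrightarrow> n \<in> carrier N \<Longrightarrow> k (basis_elem R (m, n)) = b m n"
    unfolding k_def using free_lift[OF P g] by auto
  note kD = linear_homD[OF k] and km = linear_minus[OF F.module_axioms P k]
  have bc: "\<And>m n. m \<in> carrier M \<Longrightarrow> n \<in> carrier N \<Longrightarrow> basis_elem R (m, n) \<in> carrier ?F"
    by (intro basis_elem_closed[OF R]) auto
  have "tensor_relators R M N \<subseteq> {x \<in> carrier ?F. k x = \<zero>\<^bsub>P\<^esub>}"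
  proof
    fix x assume x: "x \<in> tensor_relators R M N"
    hence "x \<in> carrier ?F" using tensor_kernel_submodule(1)[OF M N] by auto
    moreover have "k x = \<zero>\<^bsub>P\<^esub>"
      using x unfolding tensor_relators_def Let_def
      by (elim UnE CollectE exE conjE; simp add: km kD bc kb addl addr sml smr cl P.M.minus_eq P.M.r_neg)
    ultimately show "x \<in> {x \<in> carrier ?F. k x = \<zero>\<^bsub>P\<^esub>}" by auto
  qed
  hence ker: "k x = \<zero>\<^bsub>P\<^esub>" if "x \<in> ?K" for x
    using that kernel_submodule[OF F.module_axioms P k]
    unfolding tensor_kernel_def submodule_span_def by blast
  have Kc: "?K \<subseteq> carrier ?F" by (rule F.submoduleE[OF K])
  define h where "h = restrict (\<lambda>t. THE v. \<forall>f\<in>t. k f = v) (carrier ?T)"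
  have hv: "h (?K +>\<^bsub>?F\<^esub> f) = k f" if f: "f \<in> carrier ?F" for f
  proof -
    have 1: "k f' = k f" if "f' \<in> ?K +>\<^bsub>?F\<^esub> f" for f'
      using Q(5)[OF f that] ker kD f Kc by auto
    have "(THE v. \<forall>f'\<in>?K +>\<^bsub>?F\<^esub> f. k f' = v) = k f"
    proof (rule the_equality)
      show "\<forall>f'\<in>?K +>\<^bsub>?F\<^esub> f. k f' = k f" using 1 by blast
      show "v = k f" if "\<forall>f'\<in>?K +>\<^bsub>?F\<^esub> f. k f' = v" for v
        using bspec[OF that Q(4)[OF f]] by simp
    qed
    thus ?thesis using linear_homD(1)[OF Q(2) f] by (simp add: h_def)
  qed
  have hl: "h \<in> linear_hom R ?T P"
    unfolding linear_hom_def
  proof (intro CollectI conjI ballI funcsetI)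
    fix x assume "x \<in> carrier ?T"
    then obtain f where f: "f \<in> carrier ?F" "x = ?K +>\<^bsub>?F\<^esub> f" using Q(3) by blast
    show "h x \<in> carrier P" using f hv kD by auto
    fix y assume "y \<in> carrier ?T"
    then obtain f' where f': "f' \<in> carrier ?F" "y = ?K +>\<^bsub>?F\<^esub> f'" using Q(3) by blast
    show "h (x \<oplus>\<^bsub>?T\<^esub> y) = h x \<oplus>\<^bsub>P\<^esub> h y"
      using f f' hv kD(2) linear_homD(2)[OF Q(2), of f f', symmetric] by auto
  next
    fix r x assume r: "r \<in> carrier R" and "x \<in> carrier ?T"
    then obtain f where f: "f \<in> carrier ?F" "x = ?K +>\<^bsub>?F\<^esub> f" using Q(3) by blast
    show "h (r \<odot>\<^bsub>?T\<^esub> x) = r \<odot>\<^bsub>P\<^esub> h x"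
      using f r hv kD(3) linear_homD(3)[OF Q(2), of r f, symmetric] by auto
  qed
  have hp: "h (pure_tensor R M N m n) = b m n" if "m \<in> carrier M" "n \<in> carrier N" for m n
    using that hv bc kb by (simp add: pure_tensor_def)
  have he: "h \<in> extensional (carrier ?T)" unfolding h_def by (rule restrict_extensional)
  have "tensor_lift R M N P b = h"
    unfolding tensor_lift_def
  proof (rule the_equality)
    fix h' assume h': "h' \<in> linear_hom R ?T P \<and> h' \<in> extensional (carrier ?T) \<and>
      (\<forall>m\<in>carrier M. \<forall>n\<in>carrier N. h' (pure_tensor R M N m n) = b m n)"
    show "h' = h"
    proof (rule extensionalityI)
      fix t assume t: "t \<in> carrier ?T"
      show "h' t = h t"
      proof (rule tensor_hom_unique[OF M N P _ hl _ t])
        show "h' \<in> linear_hom R ?T P" using h' by blast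
        fix m n assume mn: "m \<in> carrier M" "n \<in> carrier N"
        have "h' (pure_tensor R M N m n) = b m n" using h' mn by blast
        thus "h' (pure_tensor R M N m n) = h (pure_tensor R M N m n)" using hp[OF mn] by (rule trans[OF _ sym])
      qed
    next
      show "h' \<in> extensional (carrier ?T)" using h' by blast
    next
      show "h \<in> extensional (carrier ?T)" by (rule he)
    qed
  next
    show "h \<in> linear_hom R ?T P \<and> h \<in> extensional (carrier ?T) \<and>
      (\<forall>m\<in>carrier M. \<forall>n\<in>carrier N. h (pure_tensor R M N m n) = b m n)"
      by (intro conjI ballI hl he hp)
  qed
  thus "tensor_lift R M N P b \<in> linear_hom R ?T P"
    "\<And>m n. m \<in> carrier M \<Longrightarrow> n \<in> carrier N \<Longrightarrow> tensor_lift R M N P b (pure_tensor R M N m n) = b m n"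
    using hl hp by simp_all
qed

section \<open>Coalgebras and comodules\<close>

locale coalgebra = module R C
  for R :: "('r, 'e) ring_scheme" and C :: "('r, 'c, 'm) module_scheme" +
  fixes \<Delta> :: "'c \<Rightarrow> ('c \<times> 'c \<Rightarrow> 'r) set" and \<epsilon> :: "'c \<Rightarrow> 'r"
  assumes comult_linear: "\<Delta> \<in> linear_hom R C (tensor R C C)"
    and counit_linear: "\<epsilon> \<in> linear_hom R C (ring_module R)"
    and coassociative: "\<And>c. c \<in> carrier C \<Longrightarrow>
      tensor_assoc R C C C (tensor_map R C C (tensor R C C) C \<Delta> (\<lambda>c. c) (\<Delta> c)) =
      tensor_map R C C C (tensor R C C) (\<lambda>c. c) \<Delta> (\<Delta> c)"
    and counit_left: "\<And>c. c \<in> carrier C \<Longrightarrow>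
      left_unitor R C (tensor_map R C C (ring_module R) C \<epsilon> (\<lambda>c. c) (\<Delta> c)) = c"
    and counit_right: "\<And>c. c \<in> carrier C \<Longrightarrow>
      right_unitor R C (tensor_map R C C C (ring_module R) (\<lambda>c. c) \<epsilon> (\<Delta> c)) = c"

definition coalgebra_hom ::
  "('r, 'e) ring_scheme \<Rightarrow> ('r, 'c, 'm) module_scheme \<Rightarrow> ('c \<Rightarrow> ('c \<times> 'c \<Rightarrow> 'r) set) \<Rightarrow> ('c \<Rightarrow> 'r)
    \<Rightarrow> ('r, 'd, 'n) module_scheme \<Rightarrow> ('d \<Rightarrow> ('d \<times> 'd \<Rightarrow> 'r) set) \<Rightarrow> ('d \<Rightarrow> 'r) \<Rightarrow> ('c \<Rightarrow> 'd) set"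
  where "coalgebra_hom R C \<Delta>\<^sub>C \<epsilon>\<^sub>C D \<Delta>\<^sub>D \<epsilon>\<^sub>D =
    {f \<in> linear_hom R C D. \<forall>c\<in>carrier C.
       \<Delta>\<^sub>D (f c) = tensor_map R C C D D f f (\<Delta>\<^sub>C c) \<and> \<epsilon>\<^sub>D (f c) = \<epsilon>\<^sub>C c}"

locale left_comodule = D: coalgebra R D \<Delta>\<^sub>D \<epsilon>\<^sub>D + module R M
  for R :: "('r, 'e) ring_scheme" and D :: "('r, 'd, 'n) module_scheme" and \<Delta>\<^sub>D \<epsilon>\<^sub>D
    and M :: "('r, 'a, 'm) module_scheme" +
  fixes lco :: "'a \<Rightarrow> ('d \<times> 'a \<Rightarrow> 'r) set"
  assumes lco_linear: "lco \<in> linear_hom R M (tensor R D M)"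
    and lco_coassociative: "\<And>m. m \<in> carrier M \<Longrightarrow>
      tensor_assoc R D D M (tensor_map R D M (tensor R D D) M \<Delta>\<^sub>D (\<lambda>m. m) (lco m)) =
      tensor_map R D M D (tensor R D M) (\<lambda>d. d) lco (lco m)"
    and lco_counital: "\<And>m. m \<in> carrier M \<Longrightarrow>
      left_unitor R M (tensor_map R D M (ring_module R) M \<epsilon>\<^sub>D (\<lambda>m. m) (lco m)) = m"

locale right_comodule = D: coalgebra R D \<Delta>\<^sub>D \<epsilon>\<^sub>D + module R M
  for R :: "('r, 'e) ring_scheme" and D :: "('r, 'd, 'n) module_scheme" and \<Delta>\<^sub>D \<epsilon>\<^sub>D
    and M :: "('r, 'a, 'm) module_scheme" +
  fixes rco :: "'a \<Rightarrow> ('a \<times> 'd \<Rightarrow> 'r) set"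
  assumes rco_linear: "rco \<in> linear_hom R M (tensor R M D)"
    and rco_coassociative: "\<And>m. m \<in> carrier M \<Longrightarrow>
      tensor_assoc R M D D (tensor_map R M D (tensor R M D) D rco (\<lambda>d. d) (rco m)) =
      tensor_map R M D M (tensor R D D) (\<lambda>m. m) \<Delta>\<^sub>D (rco m)"
    and rco_counital: "\<And>m. m \<in> carrier M \<Longrightarrow>
      right_unitor R M (tensor_map R M D M (ring_module R) (\<lambda>m. m) \<epsilon>\<^sub>D (rco m)) = m"

locale bicomodule = left_comodule R D \<Delta>\<^sub>D \<epsilon>\<^sub>D M lco + right_comodule R D \<Delta>\<^sub>D \<epsilon>\<^sub>D M rco
  for R :: "('r, 'e) ring_scheme" and D :: "('r, 'd, 'n) module_scheme" and \<Delta>\<^sub>D \<epsilon>\<^sub>D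
    and M :: "('r, 'a, 'm) module_scheme" and lco rco +
  assumes coactions_commute: "\<And>m. m \<in> carrier M \<Longrightarrow>
      tensor_assoc R D M D (tensor_map R M D (tensor R D M) D lco (\<lambda>d. d) (rco m)) =
      tensor_map R D M D (tensor R M D) (\<lambda>d. d) rco (lco m)"

definition bicomodule_hom ::
  "('r, 'e) ring_scheme \<Rightarrow> ('r, 'd, 'k) module_scheme
    \<Rightarrow> ('r, 'a, 'm) module_scheme \<Rightarrow> ('a \<Rightarrow> ('d \<times> 'a \<Rightarrow> 'r) set) \<Rightarrow> ('a \<Rightarrow> ('a \<times> 'd \<Rightarrow> 'r) set)
    \<Rightarrow> ('r, 'b, 'n) module_scheme \<Rightarrow> ('b \<Rightarrow> ('d \<times> 'b \<Rightarrow> 'r) set) \<Rightarrow> ('b \<Rightarrow> ('b \<times> 'd \<Rightarrow> 'r) set)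
    \<Rightarrow> ('a \<Rightarrow> 'b) set"
  where "bicomodule_hom R D M lco\<^sub>M rco\<^sub>M N lco\<^sub>N rco\<^sub>N =
    {f \<in> linear_hom R M N. \<forall>m\<in>carrier M.
       lco\<^sub>N (f m) = tensor_map R D M D N (\<lambda>d. d) f (lco\<^sub>M m) \<and>
       rco\<^sub>N (f m) = tensor_map R M D N D f (\<lambda>d. d) (rco\<^sub>M m)}"

text \<open>
  \<open>M \<otimes> N\<close> as a bicomodule over \<open>D\<close>: the left coaction is that of \<open>M\<close>, the right one that of \<open>N\<close>.
\<close>

definition tensor_lco ::
  "('r, 'e) ring_scheme \<Rightarrow> ('r, 'd, 'k) module_scheme \<Rightarrow> ('r, 'a, 'm) module_scheme
    \<Rightarrow> ('a \<Rightarrow> ('d \<times> 'a \<Rightarrow> 'r) set) \<Rightarrow> ('r, 'b, 'n) module_scheme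
    \<Rightarrow> ('a \<times> 'b \<Rightarrow> 'r) set \<Rightarrow> ('d \<times> ('a \<times> 'b \<Rightarrow> 'r) set \<Rightarrow> 'r) set"
  where "tensor_lco R D M lco N t =
    tensor_assoc R D M N (tensor_map R M N (tensor R D M) N lco (\<lambda>n. n) t)"

definition tensor_rco ::
  "('r, 'e) ring_scheme \<Rightarrow> ('r, 'd, 'k) module_scheme \<Rightarrow> ('r, 'a, 'm) module_scheme
    \<Rightarrow> ('r, 'b, 'n) module_scheme \<Rightarrow> ('b \<Rightarrow> ('b \<times> 'd \<Rightarrow> 'r) set)
    \<Rightarrow> ('a \<times> 'b \<Rightarrow> 'r) set \<Rightarrow> (('a \<times> 'b \<Rightarrow> 'r) set \<times> 'd \<Rightarrow> 'r) set"
  where "tensor_rco R D M N rco t =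
    tensor_assoc_inv R M N D (tensor_map R M N M (tensor R N D) (\<lambda>m. m) rco t)"

definition cotensor ::
  "('r, 'e) ring_scheme \<Rightarrow> ('r, 'd, 'k) module_scheme
    \<Rightarrow> ('r, 'a, 'm) module_scheme \<Rightarrow> ('a \<Rightarrow> ('a \<times> 'd \<Rightarrow> 'r) set)
    \<Rightarrow> ('r, 'b, 'n) module_scheme \<Rightarrow> ('b \<Rightarrow> ('d \<times> 'b \<Rightarrow> 'r) set) \<Rightarrow> ('a \<times> 'b \<Rightarrow> 'r) set set"
  where "cotensor R D M rco N lco =
    {t \<in> carrier (tensor R M N).
       tensor_assoc R M D N (tensor_map R M N (tensor R M D) N rco (\<lambda>n. n) t) =
       tensor_map R M N M (tensor R D N) (\<lambda>m. m) lco t}"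

section \<open>Colored coalgebras\<close>

text \<open>The coalgebra structure on the free module on \<open>X\<close> in which every \<open>x \<in> X\<close> is grouplike.\<close>

definition grouplike_comult ::
  "('r, 'e) ring_scheme \<Rightarrow> 'x set \<Rightarrow> ('x \<Rightarrow> 'r) \<Rightarrow> (('x \<Rightarrow> 'r) \<times> ('x \<Rightarrow> 'r) \<Rightarrow> 'r) set"
  where "grouplike_comult R X f =
    (let F = free_module R X; T = tensor R F F in
      finsum T (\<lambda>x. f x \<odot>\<^bsub>T\<^esub> pure_tensor R F F (basis_elem R x) (basis_elem R x))
        {x. f x \<noteq> \<zero>\<^bsub>R\<^esub>})"

definition grouplike_counit :: "('r, 'e) ring_scheme \<Rightarrow> ('x \<Rightarrow> 'r) \<Rightarrow> 'r"
  where "grouplike_counit R f = finsum R f {x. f x \<noteq> \<zero>\<^bsub>R\<^esub>}"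

locale colored_coalgebra =
  coalgebra R C \<Delta> \<epsilon> +
  bicomodule R "free_module R X" "grouplike_comult R X" "grouplike_counit R" C lco rco
  for R :: "('r, 'e) ring_scheme" and C :: "('r, 'c, 'm) module_scheme" and \<Delta> \<epsilon>
    and X :: "'x set" and lco rco +
  assumes comult_bicomodule_hom:
      "\<Delta> \<in> bicomodule_hom R (free_module R X) C lco rco
        (tensor R C C) (tensor_lco R (free_module R X) C lco C) (tensor_rco R (free_module R X) C C rco)"
    and comult_cotensor:
      "\<And>c. c \<in> carrier C \<Longrightarrow> \<Delta> c \<in> cotensor R (free_module R X) C rco C lco"

locale color_counital_coalgebra = colored_coalgebra R C \<Delta> \<epsilon> X lco rco
  for R :: "('r, 'e) ring_scheme" and C :: "('r, 'c, 'm) module_scheme" and \<Delta> \<epsilon>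
    and X :: "'x set" and lco rco +
  fixes \<epsilon>\<^sub>X :: "'c \<Rightarrow> 'x \<Rightarrow> 'r"
  assumes color_counit_coalgebra_hom:
      "\<epsilon>\<^sub>X \<in> coalgebra_hom R C \<Delta> \<epsilon> (free_module R X) (grouplike_comult R X) (grouplike_counit R)"
    and color_counit_bicomodule_hom:
      "\<epsilon>\<^sub>X \<in> bicomodule_hom R (free_module R X) C lco rco
        (free_module R X) (grouplike_comult R X) (grouplike_comult R X)"
    and color_counit_left: "\<And>c. c \<in> carrier C \<Longrightarrow>
      tensor_map R C C (free_module R X) C \<epsilon>\<^sub>X (\<lambda>c. c) (\<Delta> c) = lco c"
    and color_counit_right: "\<And>c. c \<in> carrier C \<Longrightarrow>
      tensor_map R C C C (free_module R X) (\<lambda>c. c) \<epsilon>\<^sub>X (\<Delta> c) = rco c"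

locale color_coaugmented_coalgebra = color_counital_coalgebra R C \<Delta> \<epsilon> X lco rco \<epsilon>\<^sub>X
  for R :: "('r, 'e) ring_scheme" and C :: "('r, 'c, 'm) module_scheme" and \<Delta> \<epsilon>
    and X :: "'x set" and lco rco \<epsilon>\<^sub>X +
  fixes i\<^sub>X :: "('x \<Rightarrow> 'r) \<Rightarrow> 'c"
  assumes coaugmentation_coalgebra_hom:
      "i\<^sub>X \<in> coalgebra_hom R (free_module R X) (grouplike_comult R X) (grouplike_counit R) C \<Delta> \<epsilon>"
    and coaugmentation_bicomodule_hom:
      "i\<^sub>X \<in> bicomodule_hom R (free_module R X)
        (free_module R X) (grouplike_comult R X) (grouplike_comult R X) C lco rco"
    and color_counit_coaugmentation:
      "\<And>f. f \<in> carrier (free_module R X) \<Longrightarrow> \<epsilon>\<^sub>X (i\<^sub>X f) = f"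

definition color_component ::
  "('r, 'e) ring_scheme \<Rightarrow> ('r, 'c, 'm) module_scheme \<Rightarrow> 'x set
    \<Rightarrow> ('c \<Rightarrow> (('x \<Rightarrow> 'r) \<times> 'c \<Rightarrow> 'r) set) \<Rightarrow> ('c \<Rightarrow> ('c \<times> ('x \<Rightarrow> 'r) \<Rightarrow> 'r) set)
    \<Rightarrow> 'x \<Rightarrow> 'x \<Rightarrow> 'c set"
  where "color_component R C X lco rco x y =
    {c \<in> carrier C. lco c = pure_tensor R (free_module R X) C (basis_elem R x) c \<and>
                    rco c = pure_tensor R C (free_module R X) c (basis_elem R y)}"

definition coaug_coideal ::
  "('r, 'e) ring_scheme \<Rightarrow> ('r, 'c, 'm) module_scheme \<Rightarrow> 'x set \<Rightarrow> ('c \<Rightarrow> 'x \<Rightarrow> 'r) \<Rightarrow> 'c set"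
  where "coaug_coideal R C X \<epsilon>\<^sub>X = a_kernel C (free_module R X) \<epsilon>\<^sub>X"

text \<open>
  For \<open>x \<noteq> y\<close> the following intersection is the whole component \<open>C\<^sub>x\<^sub>y\<close>, because a bicomodule map
  to the free module on \<open>X\<close> vanishes there.
\<close>

definition coaug_component ::
  "('r, 'e) ring_scheme \<Rightarrow> ('r, 'c, 'm) module_scheme \<Rightarrow> 'x set
    \<Rightarrow> ('c \<Rightarrow> (('x \<Rightarrow> 'r) \<times> 'c \<Rightarrow> 'r) set) \<Rightarrow> ('c \<Rightarrow> ('c \<times> ('x \<Rightarrow> 'r) \<Rightarrow> 'r) set)
    \<Rightarrow> ('c \<Rightarrow> 'x \<Rightarrow> 'r) \<Rightarrow> 'x \<Rightarrow> 'x \<Rightarrow> 'c set"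
  where "coaug_component R C X lco rco \<epsilon>\<^sub>X x y =
    coaug_coideal R C X \<epsilon>\<^sub>X \<inter> color_component R C X lco rco x y"

definition reduced_comult ::
  "('r, 'e) ring_scheme \<Rightarrow> ('r, 'c, 'm) module_scheme \<Rightarrow> ('c \<Rightarrow> ('c \<times> 'c \<Rightarrow> 'r) set) \<Rightarrow> 'x set
    \<Rightarrow> ('c \<Rightarrow> (('x \<Rightarrow> 'r) \<times> 'c \<Rightarrow> 'r) set) \<Rightarrow> ('c \<Rightarrow> ('c \<times> ('x \<Rightarrow> 'r) \<Rightarrow> 'r) set)
    \<Rightarrow> (('x \<Rightarrow> 'r) \<Rightarrow> 'c) \<Rightarrow> 'c \<Rightarrow> ('c \<times> 'c \<Rightarrow> 'r) set"
  where "reduced_comult R C \<Delta> X lco rco i\<^sub>X c =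
    (\<Delta> c \<ominus>\<^bsub>tensor R C C\<^esub> tensor_map R (free_module R X) C C C i\<^sub>X (\<lambda>c. c) (lco c))
      \<ominus>\<^bsub>tensor R C C\<^esub> tensor_map R C (free_module R X) C C (\<lambda>c. c) i\<^sub>X (rco c)"

text \<open>
  In the graded case all structure maps preserve degrees, where \<open>R\<close> and the free module on \<open>X\<close>
  are concentrated in degree \<open>0\<close>.
\<close>

locale graded_color_coaugmented_coalgebra =
  color_coaugmented_coalgebra R C \<Delta> \<epsilon> X lco rco \<epsilon>\<^sub>X i\<^sub>X
  for R :: "('r, 'e) ring_scheme" and C :: "('r, 'c, 'm) module_scheme" and \<Delta> \<epsilon>
    and X :: "'x set" and lco rco \<epsilon>\<^sub>X i\<^sub>X +
  fixes Cg :: "nat \<Rightarrow> 'c set"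
  assumes grading: "internal_direct_sum R C UNIV Cg (carrier C)"
    and comult_graded: "\<And>n c. c \<in> Cg n \<Longrightarrow>
      \<Delta> c \<in> sum_family (tensor R C C) {0..n} (\<lambda>i. boxtimes R C C (Cg i) (Cg (n - i)))"
    and counit_graded: "\<And>n c. 0 < n \<Longrightarrow> c \<in> Cg n \<Longrightarrow> \<epsilon> c = \<zero>\<^bsub>R\<^esub>"
    and lco_graded: "\<And>n c. c \<in> Cg n \<Longrightarrow>
      lco c \<in> boxtimes R (free_module R X) C (carrier (free_module R X)) (Cg n)"
    and rco_graded: "\<And>n c. c \<in> Cg n \<Longrightarrow>
      rco c \<in> boxtimes R C (free_module R X) (Cg n) (carrier (free_module R X))"
    and color_counit_graded: "\<And>n c. 0 < n \<Longrightarrow> c \<in> Cg n \<Longrightarrow> \<epsilon>\<^sub>X c = \<zero>\<^bsub>free_module R X\<^esub>"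
    and coaugmentation_graded: "i\<^sub>X ` carrier (free_module R X) \<subseteq> Cg 0"

locale color_reduced_coalgebra = graded_color_coaugmented_coalgebra R C \<Delta> \<epsilon> X lco rco \<epsilon>\<^sub>X i\<^sub>X Cg
  for R :: "('r, 'e) ring_scheme" and C :: "('r, 'c, 'm) module_scheme" and \<Delta> \<epsilon>
    and X :: "'x set" and lco rco \<epsilon>\<^sub>X i\<^sub>X Cg +
  assumes color_reduced: "Cg 0 = i\<^sub>X ` carrier (free_module R X)"

end

theory Submission
  imports Defs
begin

text \<open>
  Put \<open>e = i\<^sub>X \<circ> \<epsilon>\<^sub>X\<close>, an idempotent endomorphism of \<open>C\<close>, so that \<open>p = id - e\<close> projects \<open>C\<close> onto
  \<open>ker \<epsilon>\<^sub>X\<close>. Color counitality says \<open>(e \<otimes> id) \<Delta> = (i\<^sub>X \<otimes> id) \<lambda>\<close> and \<open>(id \<otimes> e) \<Delta> = (id \<otimes> i\<^sub>X) \<rho>\<close>, while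
  \<open>(e \<otimes> e) (\<Delta> c)\<close> is the image of the diagonal of \<open>\<epsilon>\<^sub>X c\<close>, which is \<open>0\<close> on \<open>ker \<epsilon>\<^sub>X\<close>. Hence the reduced diagonal
  is \<open>(p \<otimes> p) \<Delta>\<close> there, which lies in \<open>ker \<epsilon>\<^sub>X \<boxtimes> ker \<epsilon>\<^sub>X\<close>. In the color reduced case \<open>p\<close> vanishes on \<open>C\<^sub>0\<close>
  and is the identity in positive degrees, so \<open>p \<otimes> p\<close> removes exactly the two outer terms of \<open>\<Delta> c\<close>.
\<close>

subsection \<open>Linear maps\<close>

lemma linear_hom_id: "(\<lambda>x. x) \<in> linear_hom R M M"
  by (simp add: linear_hom_def)

lemma linear_hom_comp:
  assumes "f \<in> linear_hom R M N" "g \<in> linear_hom R N P"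
  shows "(\<lambda>x. g (f x)) \<in> linear_hom R M P"
  using assms by (auto simp: linear_hom_def Pi_def)

text \<open>Lets vanishing on a tensor product, or on part of one, be proved as agreement with the
  zero map through \<open>tensor_hom_unique\<close> and \<open>boxtimes_linear_cong\<close>.\<close>

lemma linear_hom_zero:
  assumes M: "module R M" and N: "module R N"
  shows "(\<lambda>x. \<zero>\<^bsub>N\<^esub>) \<in> linear_hom R M N"
proof -
  interpret N: module R N by fact
  show ?thesis by (auto simp: linear_hom_def)
qed

lemma linear_hom_minus:
  assumes M: "module R M" and N: "module R N"
    and f: "f \<in> linear_hom R M N" and g: "g \<in> linear_hom R M N"
  shows "(\<lambda>x. f x \<ominus>\<^bsub>N\<^esub> g x) \<in> linear_hom R M N"
proof -
  interpret N: module R N by fact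
  show ?thesis unfolding linear_hom_def
    using linear_homD[OF f] linear_homD[OF g]
    by (auto simp: N.M.minus_eq N.M.minus_add N.M.a_ac N.smult_r_distr N.smult_r_minus)
qed

lemma submodule_inter:
  assumes M: "module R M" and A: "submodule A R M" and B: "submodule B R M"
  shows "submodule (A \<inter> B) R M"
proof -
  interpret M: module R M by fact
  have "\<zero>\<^bsub>M\<^esub> \<in> H" if "submodule H R M" for H
    using subgroup.one_closed[OF submodule.axioms(1)[OF that]] by simp
  thus ?thesis
    using M.submoduleE[OF A] M.submoduleE[OF B] A B
    by (intro M.submoduleI) auto
qed

lemma submodule_zero_closed:
  assumes "submodule H R M" shows "\<zero>\<^bsub>M\<^esub> \<in> H"
  using subgroup.one_closed[OF submodule.axioms(1)[OF assms]] by simp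

lemma submodule_finsum_closed:
  assumes M: "module R M" and H: "submodule H R M" and "finite A" "a \<in> A \<rightarrow> H"
  shows "finsum M a A \<in> H"
proof -
  interpret M: module R M by fact
  have HM: "H \<subseteq> carrier M" by (rule M.submoduleE[OF H])
  show ?thesis using assms(3,4)
  proof induction
    case empty thus ?case using submodule_zero_closed[OF H] by simp
  next
    case (insert x F)
    hence "finsum M a (insert x F) = a x \<oplus>\<^bsub>M\<^esub> finsum M a F"
      using HM by (intro M.M.finsum_insert) auto
    thus ?case using insert M.submoduleE(5)[OF H] by auto
  qed
qed

subsection \<open>Tensor products\<close>

text \<open>The four identities are the four families of relators: the two sides are cosets of two
  elements of the free module whose difference is a relator, hence lies in the submodule divided
  out.\<close>

lemma pure_tensor_bilinear:
  assumes M: "module R M" and N: "module R N"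
  shows "m \<in> carrier M \<Longrightarrow> n \<in> carrier N \<Longrightarrow> pure_tensor R M N m n \<in> carrier (tensor R M N)"
    and "m \<in> carrier M \<Longrightarrow> m' \<in> carrier M \<Longrightarrow> n \<in> carrier N \<Longrightarrow>
      pure_tensor R M N (m \<oplus>\<^bsub>M\<^esub> m') n = pure_tensor R M N m n \<oplus>\<^bsub>tensor R M N\<^esub> pure_tensor R M N m' n"
    and "m \<in> carrier M \<Longrightarrow> n \<in> carrier N \<Longrightarrow> n' \<in> carrier N \<Longrightarrow>
      pure_tensor R M N m (n \<oplus>\<^bsub>N\<^esub> n') = pure_tensor R M N m n \<oplus>\<^bsub>tensor R M N\<^esub> pure_tensor R M N m n'"
    and "r \<in> carrier R \<Longrightarrow> m \<in> carrier M \<Longrightarrow> n \<in> carrier N \<Longrightarrow>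
      pure_tensor R M N (r \<odot>\<^bsub>M\<^esub> m) n = r \<odot>\<^bsub>tensor R M N\<^esub> pure_tensor R M N m n"
    and "r \<in> carrier R \<Longrightarrow> m \<in> carrier M \<Longrightarrow> n \<in> carrier N \<Longrightarrow>
      pure_tensor R M N m (r \<odot>\<^bsub>N\<^esub> n) = r \<odot>\<^bsub>tensor R M N\<^esub> pure_tensor R M N m n"
proof -
  interpret M: module R M by fact
  interpret N: module R N by fact
  let ?F = "free_module R (carrier M \<times> carrier N)"
  let ?K = "tensor_kernel R M N"
  note R = M.R.cring_axioms
  interpret F: module R ?F by (rule free_module_module[OF R])
  note K = tensor_kernel_submodule[OF M N]
  note Q = quotient_module_module(2)[OF F.module_axioms K(2), folded tensor_def]
  note QD = linear_homD[OF Q]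
  have e: "basis_elem R (m, n) \<in> carrier ?F" if "m \<in> carrier M" "n \<in> carrier N" for m n
    using that by (intro basis_elem_closed[OF R]) auto
  have coset_eq: "?K +>\<^bsub>?F\<^esub> u = ?K +>\<^bsub>?F\<^esub> v"
    if "u \<ominus>\<^bsub>?F\<^esub> v \<in> ?K" "u \<in> carrier ?F" "v \<in> carrier ?F" for u v
  proof -
    have "u = (u \<ominus>\<^bsub>?F\<^esub> v) \<oplus>\<^bsub>?F\<^esub> v"
      using that by (simp add: F.M.minus_eq F.M.a_assoc F.M.l_neg)
    hence "u \<in> ?K +>\<^bsub>?F\<^esub> v" using that(1) by (auto simp: a_r_coset_def')
    from F.M.a_repr_independence[OF this that(3) submodule.axioms(1)[OF K(2)]]
    show ?thesis by (rule sym)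
  qed
  have rel: "u \<ominus>\<^bsub>?F\<^esub> v \<in> tensor_relators R M N \<Longrightarrow> u \<in> carrier ?F \<Longrightarrow> v \<in> carrier ?F
      \<Longrightarrow> ?K +>\<^bsub>?F\<^esub> u = ?K +>\<^bsub>?F\<^esub> v" for u v
    using coset_eq K(3) by blast
  show "pure_tensor R M N m n \<in> carrier (tensor R M N)" if "m \<in> carrier M" "n \<in> carrier N"
    unfolding pure_tensor_def using that by (intro QD(1) e)
  show "pure_tensor R M N (m \<oplus>\<^bsub>M\<^esub> m') n = pure_tensor R M N m n \<oplus>\<^bsub>tensor R M N\<^esub> pure_tensor R M N m' n"
    if "m \<in> carrier M" "m' \<in> carrier M" "n \<in> carrier N"
    unfolding pure_tensor_def QD(2)[OF e[OF that(1,3)] e[OF that(2,3)], symmetric]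
    \<comment> \<open>The relators are a union of four sets nested to the left; the
      \<open>UnI\<close> rules select the matching family, here additivity in the first
      argument.\<close>
    by (rule rel, unfold tensor_relators_def Let_def, rule UnI1, rule UnI1, rule UnI1) (use that in \<open>blast, auto intro!: e F.M.a_closed F.smult_closed\<close>)
  show "pure_tensor R M N m (n \<oplus>\<^bsub>N\<^esub> n') = pure_tensor R M N m n \<oplus>\<^bsub>tensor R M N\<^esub> pure_tensor R M N m n'"
    if "m \<in> carrier M" "n \<in> carrier N" "n' \<in> carrier N"
    unfolding pure_tensor_def QD(2)[OF e[OF that(1,2)] e[OF that(1,3)], symmetric]
    by (rule rel, unfold tensor_relators_def Let_def, rule UnI1, rule UnI1, rule UnI2) (use that in \<open>blast, auto intro!: e F.M.a_closed F.smult_closed\<close>)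
  show "pure_tensor R M N (r \<odot>\<^bsub>M\<^esub> m) n = r \<odot>\<^bsub>tensor R M N\<^esub> pure_tensor R M N m n"
    if "r \<in> carrier R" "m \<in> carrier M" "n \<in> carrier N"
    unfolding pure_tensor_def QD(3)[OF that(1) e[OF that(2,3)], symmetric]
    by (rule rel, unfold tensor_relators_def Let_def, rule UnI1, rule UnI2) (use that in \<open>blast, auto intro!: e F.M.a_closed F.smult_closed\<close>)
  show "pure_tensor R M N m (r \<odot>\<^bsub>N\<^esub> n) = r \<odot>\<^bsub>tensor R M N\<^esub> pure_tensor R M N m n"
    if "r \<in> carrier R" "m \<in> carrier M" "n \<in> carrier N"
    unfolding pure_tensor_def QD(3)[OF that(1) e[OF that(2,3)], symmetric]
    by (rule rel, unfold tensor_relators_def Let_def, rule UnI2) (use that in \<open>blast, auto intro!: e F.M.a_closed F.smult_closed\<close>)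
qed

lemma pure_tensor_linear:
  assumes M: "module R M" and N: "module R N"
  shows "n \<in> carrier N \<Longrightarrow> (\<lambda>m. pure_tensor R M N m n) \<in> linear_hom R M (tensor R M N)"
    and "m \<in> carrier M \<Longrightarrow> pure_tensor R M N m \<in> linear_hom R N (tensor R M N)"
  by (auto simp: linear_hom_def pure_tensor_bilinear[OF M N])

section \<open>Functoriality of the tensor product\<close>

lemma tensor_map:
  assumes M: "module R M" and N: "module R N" and M': "module R M'" and N': "module R N'"
    and f: "f \<in> linear_hom R M M'" and g: "g \<in> linear_hom R N N'"
  shows "tensor_map R M N M' N' f g \<in> linear_hom R (tensor R M N) (tensor R M' N')"
    and "\<And>m n. m \<in> carrier M \<Longrightarrow> n \<in> carrier N \<Longrightarrow>
      tensor_map R M N M' N' f g (pure_tensor R M N m n) = pure_tensor R M' N' (f m) (g n)"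
  unfolding tensor_map_def
  by (rule tensor_lift[OF M N tensor_module[OF M' N']];
      simp add: pure_tensor_bilinear[OF M' N'] linear_homD[OF f] linear_homD[OF g])+

text \<open>Both sides are linear in \<open>t\<close> and take the same value on pure tensors, which
  determine a linear map.\<close>

lemma tensor_map_comp:
  assumes M: "module R M" and N: "module R N" and M': "module R M'" and N': "module R N'"
    and M'': "module R M''" and N'': "module R N''"
    and f: "f \<in> linear_hom R M M'" and g: "g \<in> linear_hom R N N'"
    and f': "f' \<in> linear_hom R M' M''" and g': "g' \<in> linear_hom R N' N''"
    and t: "t \<in> carrier (tensor R M N)"
  shows "tensor_map R M' N' M'' N'' f' g' (tensor_map R M N M' N' f g t)
    = tensor_map R M N M'' N'' (\<lambda>x. f' (f x)) (\<lambda>x. g' (g x)) t"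
proof -
  note fg = tensor_map[OF M N M' N' f g] and fg' = tensor_map[OF M' N' M'' N'' f' g']
  note comp = tensor_map[OF M N M'' N'' linear_hom_comp[OF f f'] linear_hom_comp[OF g g']]
  show ?thesis
    by (rule tensor_hom_unique[OF M N tensor_module[OF M'' N''] linear_hom_comp[OF fg(1) fg'(1)] comp(1) _ t])
       (simp add: fg(2) fg'(2) comp(2) linear_homD(1)[OF f] linear_homD(1)[OF g])
qed

lemma tensor_map_id:
  assumes M: "module R M" and N: "module R N" and t: "t \<in> carrier (tensor R M N)"
  shows "tensor_map R M N M N (\<lambda>x. x) (\<lambda>x. x) t = t"
  using tensor_map[OF M N M N linear_hom_id linear_hom_id]
  by (intro tensor_hom_unique[OF M N tensor_module[OF M N] _ linear_hom_id _ t])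

text \<open>For fixed n the map sending m to m \<otimes> n is linear, so it respects differences.
  Together with its mirror image this expands (id - e) \<otimes> (id - e) below.\<close>

lemma tensor_map_minus_left:
  assumes M: "module R M" and N: "module R N" and M': "module R M'" and N': "module R N'"
    and f: "f \<in> linear_hom R M M'" and f': "f' \<in> linear_hom R M M'" and g: "g \<in> linear_hom R N N'"
    and t: "t \<in> carrier (tensor R M N)"
  shows "tensor_map R M N M' N' (\<lambda>x. f x \<ominus>\<^bsub>M'\<^esub> f' x) g t
    = tensor_map R M N M' N' f g t \<ominus>\<^bsub>tensor R M' N'\<^esub> tensor_map R M N M' N' f' g t"
proof -
  note T' = tensor_module[OF M' N']
  note t1 = tensor_map[OF M N M' N' f g] and t2 = tensor_map[OF M N M' N' f' g]
    and t3 = tensor_map[OF M N M' N' linear_hom_minus[OF M M' f f'] g]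
  show ?thesis
    by (rule tensor_hom_unique[OF M N T' t3(1) linear_hom_minus[OF tensor_module[OF M N] T' t1(1) t2(1)] _ t])
       (simp add: t1(2) t2(2) t3(2) linear_homD(1)[OF f] linear_homD(1)[OF f'] linear_homD(1)[OF g]
         linear_minus[OF M' T' pure_tensor_linear(1)[OF M' N']])
qed

lemma tensor_map_minus_right:
  assumes M: "module R M" and N: "module R N" and M': "module R M'" and N': "module R N'"
    and f: "f \<in> linear_hom R M M'" and g: "g \<in> linear_hom R N N'" and g': "g' \<in> linear_hom R N N'"
    and t: "t \<in> carrier (tensor R M N)"
  shows "tensor_map R M N M' N' f (\<lambda>x. g x \<ominus>\<^bsub>N'\<^esub> g' x) t
    = tensor_map R M N M' N' f g t \<ominus>\<^bsub>tensor R M' N'\<^esub> tensor_map R M N M' N' f g' t"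
proof -
  note T' = tensor_module[OF M' N']
  note t1 = tensor_map[OF M N M' N' f g] and t2 = tensor_map[OF M N M' N' f g']
    and t3 = tensor_map[OF M N M' N' f linear_hom_minus[OF N N' g g']]
  show ?thesis
    by (rule tensor_hom_unique[OF M N T' t3(1) linear_hom_minus[OF tensor_module[OF M N] T' t1(1) t2(1)] _ t])
       (simp add: t1(2) t2(2) t3(2) linear_homD(1)[OF f] linear_homD(1)[OF g] linear_homD(1)[OF g']
         linear_minus[OF N' T' pure_tensor_linear(2)[OF M' N']])
qed

subsection \<open>The submodules \<open>A \<boxtimes> B\<close>\<close>

text \<open>A linear map commutes with the finite sums of pure tensors that make up
  \<open>boxtimes\<close>, and a submodule is closed under finite sums; hence only pure tensors have
  to be tested.\<close>

lemma boxtimes_linear_closed: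
  assumes M: "module R M" and N: "module R N" and P: "module R P"
    and A: "A \<subseteq> carrier M" and B: "B \<subseteq> carrier N"
    and h: "h \<in> linear_hom R (tensor R M N) P" and H: "submodule H R P"
    and pure: "\<And>a b. a \<in> A \<Longrightarrow> b \<in> B \<Longrightarrow> h (pure_tensor R M N a b) \<in> H"
    and t: "t \<in> boxtimes R M N A B"
  shows "h t \<in> H"
proof -
  note pt = pure_tensor_bilinear(1)[OF M N]
  obtain k :: nat and a b where ab: "a \<in> {..<k} \<rightarrow> A" "b \<in> {..<k} \<rightarrow> B"
    and te: "t = finsum (tensor R M N) (\<lambda>i. pure_tensor R M N (a i) (b i)) {..<k}"
    using t unfolding boxtimes_def by blast
  have cl: "(\<lambda>i. pure_tensor R M N (a i) (b i)) \<in> {..<k} \<rightarrow> carrier (tensor R M N)"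
    using ab A B by (auto intro!: pt)
  have "h t = finsum P (\<lambda>i. h (pure_tensor R M N (a i) (b i))) {..<k}"
    unfolding te by (rule finsum_linear(1)[OF tensor_module[OF M N] P h _ cl]) simp
  also have "\<dots> \<in> H"
    by (rule submodule_finsum_closed[OF P H]) (use ab in \<open>auto intro!: pure\<close>)
  finally show ?thesis .
qed

text \<open>A local form of \<open>tensor_hom_unique\<close>. The projections below have prescribed
  values on the summands of a decomposition, so agreement is tested on pure tensors from such
  summands.\<close>

lemma boxtimes_linear_cong:
  assumes M: "module R M" and N: "module R N" and P: "module R P"
    and A: "A \<subseteq> carrier M" and B: "B \<subseteq> carrier N"
    and h: "h \<in> linear_hom R (tensor R M N) P" and h': "h' \<in> linear_hom R (tensor R M N) P"
    and pure: "\<And>a b. a \<in> A \<Longrightarrow> b \<in> B \<Longrightarrow> h (pure_tensor R M N a b) = h' (pure_tensor R M N a b)"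
    and t: "t \<in> boxtimes R M N A B"
  shows "h t = h' t"
proof -
  interpret P: module R P by fact
  note pt = pure_tensor_bilinear(1)[OF M N]
  obtain k :: nat and a b where ab: "a \<in> {..<k} \<rightarrow> A" "b \<in> {..<k} \<rightarrow> B"
    and te: "t = finsum (tensor R M N) (\<lambda>i. pure_tensor R M N (a i) (b i)) {..<k}"
    using t unfolding boxtimes_def by blast
  have cl: "(\<lambda>i. pure_tensor R M N (a i) (b i)) \<in> {..<k} \<rightarrow> carrier (tensor R M N)"
    using ab A B by (auto intro!: pt)
  note lin = finsum_linear(1)[OF tensor_module[OF M N] P _ finite_lessThan cl]
  show ?thesis unfolding te lin[OF h] lin[OF h']
    by (rule P.M.finsum_cong')
       (use ab cl linear_homD(1)[OF h'] in \<open>auto intro!: pure\<close>)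
qed

text \<open>Appends one summand to a family indexed by \<open>{..<k}\<close>. Adding summands one at
  a time spares the concatenation of two families with shifted indices in the proof of closure under
  addition.\<close>

lemma boxtimes_add_pure:
  assumes M: "module R M" and N: "module R N" and A: "A \<subseteq> carrier M" and B: "B \<subseteq> carrier N"
    and t: "t \<in> boxtimes R M N A B" and m: "m \<in> A" and n: "n \<in> B"
  shows "pure_tensor R M N m n \<oplus>\<^bsub>tensor R M N\<^esub> t \<in> boxtimes R M N A B"
proof -
  interpret T: module R "tensor R M N" by (rule tensor_module[OF M N])
  note pt = pure_tensor_bilinear(1)[OF M N]
  obtain k :: nat and a b where ab: "a \<in> {..<k} \<rightarrow> A" "b \<in> {..<k} \<rightarrow> B"
    and te: "t = finsum (tensor R M N) (\<lambda>i. pure_tensor R M N (a i) (b i)) {..<k}"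
    using t unfolding boxtimes_def by blast
  have "finsum (tensor R M N) (\<lambda>i. pure_tensor R M N ((a(k := m)) i) ((b(k := n)) i)) {..<Suc k}
    = pure_tensor R M N m n \<oplus>\<^bsub>tensor R M N\<^esub>
      finsum (tensor R M N) (\<lambda>i. pure_tensor R M N ((a(k := m)) i) ((b(k := n)) i)) {..<k}"
    unfolding lessThan_Suc
    by (subst T.M.finsum_insert) (use ab m n A B in \<open>auto intro!: pt\<close>)
  \<comment> \<open>The updates at \<open>k\<close> are invisible at indices below
    \<open>k\<close>.\<close>
  also have "finsum (tensor R M N) (\<lambda>i. pure_tensor R M N ((a(k := m)) i) ((b(k := n)) i)) {..<k} = t"
    unfolding te by (rule T.M.finsum_cong') (use ab A B in \<open>auto intro!: pt\<close>)
  finally have "pure_tensor R M N m n \<oplus>\<^bsub>tensor R M N\<^esub> t =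
      finsum (tensor R M N) (\<lambda>i. pure_tensor R M N ((a(k := m)) i) ((b(k := n)) i)) {..<Suc k}" ..
  moreover have "a(k := m) \<in> {..<Suc k} \<rightarrow> A" "b(k := n) \<in> {..<Suc k} \<rightarrow> B"
    using ab m n by (auto simp: Pi_def less_Suc_eq)
  ultimately show ?thesis unfolding boxtimes_def by blast
qed

lemma boxtimes_submodule:
  assumes M: "module R M" and N: "module R N" and A: "submodule A R M" and B: "submodule B R N"
  shows "submodule (boxtimes R M N A B) R (tensor R M N)"
proof -
  interpret M: module R M by fact
  interpret N: module R N by fact
  interpret T: module R "tensor R M N" by (rule tensor_module[OF M N])
  note pt = pure_tensor_bilinear[OF M N]
  have AM: "A \<subseteq> carrier M" and BN: "B \<subseteq> carrier N"
    by (rule M.submoduleE[OF A], rule N.submoduleE[OF B])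
  let ?S = "boxtimes R M N A B"
  have Sc: "?S \<subseteq> carrier (tensor R M N)"
    unfolding boxtimes_def using AM BN by (auto intro!: T.M.finsum_closed pt(1))
  have zero: "\<zero>\<^bsub>tensor R M N\<^esub> \<in> ?S"
    unfolding boxtimes_def by (intro CollectI exI[of _ 0]) auto
  have add: "s \<oplus>\<^bsub>tensor R M N\<^esub> t \<in> ?S" if s: "s \<in> ?S" and t: "t \<in> ?S" for s t
  proof -
    obtain k :: nat and a b where ab: "a \<in> {..<k} \<rightarrow> A" "b \<in> {..<k} \<rightarrow> B"
      and se: "s = finsum (tensor R M N) (\<lambda>i. pure_tensor R M N (a i) (b i)) {..<k}"
      using s unfolding boxtimes_def by blast
    \<comment> \<open>Induction on the number of summands of \<open>s\<close>: the last one is split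
      off and added to the remaining sum plus \<open>t\<close>, which the induction hypothesis
      covers.\<close>
    have "finsum (tensor R M N) (\<lambda>i. pure_tensor R M N (a i) (b i)) {..<k} \<oplus>\<^bsub>tensor R M N\<^esub> t \<in> ?S"
      using ab
    proof (induction k)
      case 0 thus ?case using t Sc by auto
    next
      case (Suc k)
      let ?s = "finsum (tensor R M N) (\<lambda>i. pure_tensor R M N (a i) (b i)) {..<k}"
      have ak: "a k \<in> A" "b k \<in> B" and ab: "a \<in> {..<k} \<rightarrow> A" "b \<in> {..<k} \<rightarrow> B" using Suc.prems by auto
      have cl: "(\<lambda>i. pure_tensor R M N (a i) (b i)) \<in> {..<k} \<rightarrow> carrier (tensor R M N)"
        "pure_tensor R M N (a k) (b k) \<in> carrier (tensor R M N)" "t \<in> carrier (tensor R M N)"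
        using ab ak AM BN t Sc by (auto intro!: pt(1))
      have "finsum (tensor R M N) (\<lambda>i. pure_tensor R M N (a i) (b i)) {..<Suc k} \<oplus>\<^bsub>tensor R M N\<^esub> t
        = pure_tensor R M N (a k) (b k) \<oplus>\<^bsub>tensor R M N\<^esub> (?s \<oplus>\<^bsub>tensor R M N\<^esub> t)"
        unfolding lessThan_Suc using cl by (simp add: T.M.finsum_insert T.M.a_assoc)
      also have "\<dots> \<in> ?S"
        by (rule boxtimes_add_pure[OF M N AM BN Suc.IH[OF ab] ak])
      finally show ?case .
    qed
    thus ?thesis by (simp add: se)
  qed
  have smult: "r \<odot>\<^bsub>tensor R M N\<^esub> t \<in> ?S" if r: "r \<in> carrier R" and t: "t \<in> ?S" for r t
  proof -
    obtain k :: nat and a b where ab: "a \<in> {..<k} \<rightarrow> A" "b \<in> {..<k} \<rightarrow> B"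
      and te: "t = finsum (tensor R M N) (\<lambda>i. pure_tensor R M N (a i) (b i)) {..<k}"
      using t unfolding boxtimes_def by blast
    \<comment> \<open>The scalar is absorbed by the left factor, since \<open>A\<close> is a
      submodule.\<close>
    have "r \<odot>\<^bsub>tensor R M N\<^esub> t
      = finsum (tensor R M N) (\<lambda>i. r \<odot>\<^bsub>tensor R M N\<^esub> pure_tensor R M N (a i) (b i)) {..<k}"
      unfolding te by (rule T.finsum_smult_ldistr) (use r ab AM BN in \<open>auto intro!: pt(1)\<close>)
    also have "\<dots> = finsum (tensor R M N) (\<lambda>i. pure_tensor R M N (r \<odot>\<^bsub>M\<^esub> a i) (b i)) {..<k}"
      by (rule T.M.finsum_cong') (use r ab AM BN in \<open>auto simp: pt(4) Pi_def subset_iff intro!: pt(1)\<close>)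
    finally have "r \<odot>\<^bsub>tensor R M N\<^esub> t
      = finsum (tensor R M N) (\<lambda>i. pure_tensor R M N (r \<odot>\<^bsub>M\<^esub> a i) (b i)) {..<k}" .
    moreover have "(\<lambda>i. r \<odot>\<^bsub>M\<^esub> a i) \<in> {..<k} \<rightarrow> A"
      using ab r M.submoduleE(4)[OF A] by auto
    ultimately show ?thesis unfolding boxtimes_def using ab(2)
      by (intro CollectI exI[of _ k] exI[of _ "\<lambda>i. r \<odot>\<^bsub>M\<^esub> a i"] exI[of _ b] conjI)
  qed
  show ?thesis
  proof (rule T.submoduleI[OF Sc zero _ add smult])
    fix t assume t: "t \<in> ?S"
    \<comment> \<open>Negation is multiplication by -1, hence a case of closure under
      scalars.\<close>
    have "\<ominus>\<^bsub>tensor R M N\<^esub> t = (\<ominus>\<^bsub>R\<^esub> \<one>\<^bsub>R\<^esub>) \<odot>\<^bsub>tensor R M N\<^esub> t"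
      using t Sc by (auto simp: T.smult_l_minus)
    thus "\<ominus>\<^bsub>tensor R M N\<^esub> t \<in> ?S" using smult t by simp
  qed
qed

lemma pure_tensor_in_boxtimes:
  assumes M: "module R M" and N: "module R N" and A: "submodule A R M" and B: "submodule B R N"
    and m: "m \<in> A" and n: "n \<in> B"
  shows "pure_tensor R M N m n \<in> boxtimes R M N A B"
proof -
  interpret M: module R M by fact
  interpret N: module R N by fact
  interpret T: module R "tensor R M N" by (rule tensor_module[OF M N])
  have AM: "A \<subseteq> carrier M" and BN: "B \<subseteq> carrier N"
    by (rule M.submoduleE[OF A], rule N.submoduleE[OF B])
  have "pure_tensor R M N m n \<oplus>\<^bsub>tensor R M N\<^esub> \<zero>\<^bsub>tensor R M N\<^esub> \<in> boxtimes R M N A B"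
    by (intro boxtimes_add_pure[OF M N AM BN _ m n]
        submodule_zero_closed[OF boxtimes_submodule[OF M N A B]])
  moreover have "pure_tensor R M N m n \<in> carrier (tensor R M N)"
    using m n AM BN by (auto intro!: pure_tensor_bilinear(1)[OF M N])
  ultimately show ?thesis by simp
qed

text \<open>The projection to the quotient by \<open>M \<boxtimes> N\<close> kills all pure tensors, hence is zero.\<close>

lemma boxtimes_carrier:
  assumes M: "module R M" and N: "module R N"
  shows "boxtimes R M N (carrier M) (carrier N) = carrier (tensor R M N)"
proof
  interpret M: module R M by fact
  interpret N: module R N by fact
  interpret T: module R "tensor R M N" by (rule tensor_module[OF M N])
  let ?S = "boxtimes R M N (carrier M) (carrier N)"
  note S = boxtimes_submodule[OF M N M.carrier_is_submodule N.carrier_is_submodule]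
  note Q = quotient_module_module[OF T.module_axioms S]
  let ?Q = "quotient_module (tensor R M N) ?S"
  show "?S \<subseteq> carrier (tensor R M N)" by (rule T.submoduleE[OF S])
  show "carrier (tensor R M N) \<subseteq> ?S"
  proof
    fix t assume t: "t \<in> carrier (tensor R M N)"
    have "?S +>\<^bsub>tensor R M N\<^esub> t = \<zero>\<^bsub>?Q\<^esub>"
    proof (rule tensor_hom_unique[OF M N Q(1) Q(2) linear_hom_zero[OF T.module_axioms Q(1)] _ t])
      fix m n assume mn: "m \<in> carrier M" "n \<in> carrier N"
      have "pure_tensor R M N m n \<in> ?S"
        by (rule pure_tensor_in_boxtimes[OF M N M.carrier_is_submodule N.carrier_is_submodule mn])
      thus "?S +>\<^bsub>tensor R M N\<^esub> pure_tensor R M N m n = \<zero>\<^bsub>?Q\<^esub>"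
        using T.M.a_coset_join2[OF _ submodule.axioms(1)[OF S]] T.submoduleE(1)[OF S]
        by (auto simp: quotient_module_def)
    qed
    \<comment> \<open>The zero of the quotient is \<open>?S\<close> itself, and \<open>t\<close>
      lies in its own coset.\<close>
    thus "t \<in> ?S" using Q(4)[OF t] by (simp add: quotient_module_def)
  qed
qed

text \<open>Applied below with \<open>coaug_projection\<close> in both factors: once with the
  coideal as target of each, once degree by degree.\<close>

lemma tensor_map_boxtimes:
  assumes M: "module R M" and N: "module R N" and M': "module R M'" and N': "module R N'"
    and f: "f \<in> linear_hom R M M'" and g: "g \<in> linear_hom R N N'"
    and A: "A \<subseteq> carrier M" and B: "B \<subseteq> carrier N"
    and A': "submodule A' R M'" and B': "submodule B' R N'"
    and fA: "f ` A \<subseteq> A'" and gB: "g ` B \<subseteq> B'"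
    and t: "t \<in> boxtimes R M N A B"
  shows "tensor_map R M N M' N' f g t \<in> boxtimes R M' N' A' B'"
proof (rule boxtimes_linear_closed[OF M N tensor_module[OF M' N'] A B _ boxtimes_submodule[OF M' N' A' B'] _ t])
  note fg = tensor_map[OF M N M' N' f g]
  show "tensor_map R M N M' N' f g \<in> linear_hom R (tensor R M N) (tensor R M' N')" by (rule fg)
  fix a b assume ab: "a \<in> A" "b \<in> B"
  hence "tensor_map R M N M' N' f g (pure_tensor R M N a b) = pure_tensor R M' N' (f a) (g b)"
    using A B by (intro fg(2)) auto
  thus "tensor_map R M N M' N' f g (pure_tensor R M N a b) \<in> boxtimes R M' N' A' B'"
    using ab fA gB by (auto intro!: pure_tensor_in_boxtimes[OF M' N' A' B'])
qed

subsection \<open>Direct sums\<close>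

text \<open>By independence the component of an element in the \<open>i\<close>-th summand is well
  defined. Sums and multiples of decompositions, taken componentwise, are again decompositions, so
  taking the component is linear.\<close>

lemma internal_direct_sum_projection:
  assumes M: "module R M" and ds: "internal_direct_sum R M I N (carrier M)" and i: "i \<in> I"
  shows "\<exists>\<pi>\<in>linear_hom R M M. (\<forall>x\<in>N i. \<pi> x = x) \<and> (\<forall>j\<in>I. j \<noteq> i \<longrightarrow> (\<forall>x\<in>N j. \<pi> x = \<zero>\<^bsub>M\<^esub>))"
proof -
  interpret M: module R M by fact
  have sub: "submodule (N j) R M" if "j \<in> I" for j
    using ds that unfolding internal_direct_sum_def by blast
  note NM = M.submoduleE(1)[OF sub]
  have indep: "\<forall>j\<in>J. a j = \<zero>\<^bsub>M\<^esub>"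
    if "finite J" "J \<subseteq> I" "a \<in> (\<Pi> j\<in>J. N j)" "finsum M a J = \<zero>\<^bsub>M\<^esub>" for J a
    using ds that unfolding internal_direct_sum_def by blast
  \<comment> \<open>\<open>D c f\<close> says that \<open>f\<close> lists the components of
    \<open>c\<close>. Padding with zero outside the finite set \<open>J\<close> frees
    \<open>f\<close> from the choice of \<open>J\<close>, so that uniqueness becomes an equality of
    functions.\<close>
  define D where "D c f \<longleftrightarrow> (\<exists>J. finite J \<and> J \<subseteq> I \<and> f \<in> (\<Pi> j\<in>J. N j) \<and>
      (\<forall>j. j \<notin> J \<longrightarrow> f j = \<zero>\<^bsub>M\<^esub>) \<and> c = finsum M f J)" for c f
  have cl: "f j \<in> carrier M" if "D c f" for c f j
  proof -
    obtain J where J: "J \<subseteq> I" "f \<in> (\<Pi> j\<in>J. N j)" "\<forall>j. j \<notin> J \<longrightarrow> f j = \<zero>\<^bsub>M\<^esub>"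
      using \<open>D c f\<close> unfolding D_def by blast
    show ?thesis
    proof (cases "j \<in> J")
      case True
      hence "f j \<in> N j" "j \<in> I" using J by auto
      thus ?thesis using NM by blast
    qed (simp add: J(3))
  qed
  \<comment> \<open>Two decompositions are added over the union of their index sets; the padding
    zeros change neither the sums nor the membership in the summands.\<close>
  have enlarge: "finsum M f J = finsum M f K" "f \<in> (\<Pi> j\<in>K. N j)"
    if "J \<subseteq> K" "finite K" "K \<subseteq> I" "f \<in> (\<Pi> j\<in>J. N j)" "\<forall>j. j \<notin> J \<longrightarrow> f j = \<zero>\<^bsub>M\<^esub>" for f J K
  proof -
    show *: "f \<in> (\<Pi> j\<in>K. N j)"
    proof
      fix j assume "j \<in> K"
      thus "f j \<in> N j" using that submodule_zero_closed[OF sub, of j] by (cases "j \<in> J") auto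
    qed
    have "f j \<in> carrier M" if "j \<in> K" for j
      using * NM that \<open>K \<subseteq> I\<close> by blast
    thus "finsum M f J = finsum M f K"
      using that(1,2,5) by (intro M.M.add.finprod_mono_neutral_cong_left) auto
  qed
  have Dadd: "D (c \<oplus>\<^bsub>M\<^esub> d) (\<lambda>j. f j \<oplus>\<^bsub>M\<^esub> g j)" if f: "D c f" and g: "D d g" for c d f g
  proof -
    obtain J where J: "finite J" "J \<subseteq> I" "f \<in> (\<Pi> j\<in>J. N j)" "\<forall>j. j \<notin> J \<longrightarrow> f j = \<zero>\<^bsub>M\<^esub>" "c = finsum M f J"
      using f unfolding D_def by blast
    obtain K where K: "finite K" "K \<subseteq> I" "g \<in> (\<Pi> j\<in>K. N j)" "\<forall>j. j \<notin> K \<longrightarrow> g j = \<zero>\<^bsub>M\<^esub>" "d = finsum M g K"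
      using g unfolding D_def by blast
    have fin: "finite (J \<union> K)" "J \<union> K \<subseteq> I" using J K by auto
    have ef: "c = finsum M f (J \<union> K)" "f \<in> (\<Pi> j\<in>J \<union> K. N j)"
      using enlarge[OF _ fin J(3,4)] J(5) by auto
    have eg: "d = finsum M g (J \<union> K)" "g \<in> (\<Pi> j\<in>J \<union> K. N j)"
      using enlarge[OF _ fin K(3,4)] K(5) by auto
    have "c \<oplus>\<^bsub>M\<^esub> d = finsum M (\<lambda>j. f j \<oplus>\<^bsub>M\<^esub> g j) (J \<union> K)"
      unfolding ef(1) eg(1) by (rule M.M.finsum_addf[symmetric]) (use cl[OF f] cl[OF g] in auto)
    moreover have "(\<lambda>j. f j \<oplus>\<^bsub>M\<^esub> g j) \<in> (\<Pi> j\<in>J \<union> K. N j)"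
    proof
      fix j assume j: "j \<in> J \<union> K"
      hence "j \<in> I" using fin by auto
      thus "f j \<oplus>\<^bsub>M\<^esub> g j \<in> N j" using M.submoduleE(5)[OF sub] ef(2) eg(2) j by blast
    qed
    moreover have "\<forall>j. j \<notin> J \<union> K \<longrightarrow> f j \<oplus>\<^bsub>M\<^esub> g j = \<zero>\<^bsub>M\<^esub>"
      using J(4) K(4) by simp
    ultimately show ?thesis unfolding D_def using fin
      by (intro exI[of _ "J \<union> K"] conjI)
  qed
  have Dsmult: "D (r \<odot>\<^bsub>M\<^esub> c) (\<lambda>j. r \<odot>\<^bsub>M\<^esub> f j)" if r: "r \<in> carrier R" and f: "D c f" for r c f
  proof -
    obtain J where J: "finite J" "J \<subseteq> I" "f \<in> (\<Pi> j\<in>J. N j)" "\<forall>j. j \<notin> J \<longrightarrow> f j = \<zero>\<^bsub>M\<^esub>" "c = finsum M f J"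
      using f unfolding D_def by blast
    have "r \<odot>\<^bsub>M\<^esub> c = finsum M (\<lambda>j. r \<odot>\<^bsub>M\<^esub> f j) J"
      unfolding J(5) by (rule M.finsum_smult_ldistr) (use r J(1) cl[OF f] in auto)
    moreover have "(\<lambda>j. r \<odot>\<^bsub>M\<^esub> f j) \<in> (\<Pi> j\<in>J. N j)"
    proof
      fix j assume j: "j \<in> J"
      hence "j \<in> I" using J by auto
      thus "r \<odot>\<^bsub>M\<^esub> f j \<in> N j" using M.submoduleE(4)[OF sub] J(3) j r by blast
    qed
    moreover have "\<forall>j. j \<notin> J \<longrightarrow> r \<odot>\<^bsub>M\<^esub> f j = \<zero>\<^bsub>M\<^esub>"
      using J(4) r by simp
    ultimately show ?thesis unfolding D_def using J(1,2)
      by (intro exI[of _ J] conjI)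
  qed
  have Duniq: "f = g" if f: "D c f" and g: "D c g" and c: "c \<in> carrier M" for c f g
  proof
    fix j
    \<comment> \<open>The difference of \<open>f\<close> and \<open>g\<close>, written with the
      scalar -1 so that \<open>Dadd\<close> and \<open>Dsmult\<close> apply. It decomposes c - c =
      0, and independence makes it vanish.\<close>
    let ?u = "\<lambda>j. f j \<oplus>\<^bsub>M\<^esub> (\<ominus>\<^bsub>R\<^esub> \<one>\<^bsub>R\<^esub>) \<odot>\<^bsub>M\<^esub> g j"
    have "D (c \<oplus>\<^bsub>M\<^esub> (\<ominus>\<^bsub>R\<^esub> \<one>\<^bsub>R\<^esub>) \<odot>\<^bsub>M\<^esub> c) ?u" by (intro Dadd Dsmult f g) simp
    moreover have "c \<oplus>\<^bsub>M\<^esub> (\<ominus>\<^bsub>R\<^esub> \<one>\<^bsub>R\<^esub>) \<odot>\<^bsub>M\<^esub> c = \<zero>\<^bsub>M\<^esub>"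
      using c by (simp add: M.smult_l_minus M.M.r_neg)
    ultimately have "D \<zero>\<^bsub>M\<^esub> ?u" by simp
    then obtain J where J: "finite J" "J \<subseteq> I" "?u \<in> (\<Pi> j\<in>J. N j)"
      and u0: "\<forall>j. j \<notin> J \<longrightarrow> ?u j = \<zero>\<^bsub>M\<^esub>" and z: "\<zero>\<^bsub>M\<^esub> = finsum M ?u J"
      unfolding D_def by (elim exE conjE) (rule that)
    have "?u j = \<zero>\<^bsub>M\<^esub>"
    proof (cases "j \<in> J")
      case True thus ?thesis using indep[OF J z[symmetric]] by blast
    next
      case False thus ?thesis using u0 by blast
    qed
    hence "f j \<ominus>\<^bsub>M\<^esub> g j = \<zero>\<^bsub>M\<^esub>"
      using cl[OF g] by (simp add: M.smult_l_minus M.M.minus_eq)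
    moreover have "f j = (f j \<ominus>\<^bsub>M\<^esub> g j) \<oplus>\<^bsub>M\<^esub> g j"
      using cl[OF f] cl[OF g] by (simp add: M.M.minus_eq M.M.a_assoc M.M.l_neg)
    ultimately show "f j = g j" using cl[OF g] by simp
  qed
  have Dex: "\<exists>f. D c f" if "c \<in> carrier M" for c
  proof -
    have "c \<in> sum_family M I N" using ds that unfolding internal_direct_sum_def by simp
    then obtain J a where J: "finite J" "J \<subseteq> I" "a \<in> (\<Pi> j\<in>J. N j)" "c = finsum M a J"
      unfolding sum_family_def by blast
    have "a j \<in> carrier M" if "j \<in> J" for j using J(2,3) NM that by blast
    \<comment> \<open>The family given by \<open>sum_family\<close> is arbitrary outside
      \<open>J\<close> and is reset to zero there, as \<open>D\<close> demands.\<close>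
    hence "c = finsum M (\<lambda>j. if j \<in> J then a j else \<zero>\<^bsub>M\<^esub>) J"
      unfolding J(4) by (intro M.M.finsum_cong') auto
    hence "D c (\<lambda>j. if j \<in> J then a j else \<zero>\<^bsub>M\<^esub>)"
      unfolding D_def using J by (intro exI[of _ J]) auto
    thus ?thesis by blast
  qed
  \<comment> \<open>The unique family of components, evaluated at \<open>i\<close>.\<close>
  define \<pi> where "\<pi> c = (THE f. D c f) i" for c
  have \<pi>: "\<pi> c = f i" if "D c f" "c \<in> carrier M" for c f
  proof -
    have "(THE f. D c f) = f"
      by (rule the_equality) (rule that(1), rule Duniq[OF _ that])
    thus ?thesis by (simp add: \<pi>_def)
  qed
  \<comment> \<open>An element of a single summand has a one-term decomposition; its value at
    \<open>i\<close> gives both prescribed values of \<open>\<pi>\<close>.\<close>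
  have Dsingle: "D x (\<lambda>k. if k = j then x else \<zero>\<^bsub>M\<^esub>)" if "j \<in> I" "x \<in> N j" for j x
    unfolding D_def using that NM[OF that(1)] by (intro exI[of _ "{j}"]) auto
  show ?thesis
  proof (intro bexI[of _ \<pi>] conjI ballI impI)
    show "\<pi> \<in> linear_hom R M M" unfolding linear_hom_def
    proof (intro CollectI conjI ballI funcsetI)
      fix c assume c: "c \<in> carrier M"
      obtain f where f: "D c f" using Dex[OF c] by blast
      show "\<pi> c \<in> carrier M" using \<pi>[OF f c] cl[OF f] by simp
      fix d assume d: "d \<in> carrier M"
      obtain g where g: "D d g" using Dex[OF d] by blast
      show "\<pi> (c \<oplus>\<^bsub>M\<^esub> d) = \<pi> c \<oplus>\<^bsub>M\<^esub> \<pi> d"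
        using \<pi>[OF f c] \<pi>[OF g d] \<pi>[OF Dadd[OF f g]] c d by simp
    next
      fix r c assume r: "r \<in> carrier R" and c: "c \<in> carrier M"
      obtain f where f: "D c f" using Dex[OF c] by blast
      show "\<pi> (r \<odot>\<^bsub>M\<^esub> c) = r \<odot>\<^bsub>M\<^esub> \<pi> c"
        using \<pi>[OF f c] \<pi>[OF Dsmult[OF r f]] r c by simp
    qed
  next
    fix x assume "x \<in> N i"
    thus "\<pi> x = x" using \<pi>[OF Dsingle[OF i]] NM[OF i] by auto
  next
    fix j x assume "j \<in> I" "j \<noteq> i" "x \<in> N j"
    thus "\<pi> x = \<zero>\<^bsub>M\<^esub>" using \<pi>[OF Dsingle[of j x]] NM[of j] by auto
  qed
qed

text \<open>Independence: a projection \<open>\<pi>\<close> onto the summand \<open>A j\<close> gives \<open>\<pi> \<otimes> id\<close>, which isolates the \<open>j\<close>-th term.\<close>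

lemma internal_direct_sum_boxtimes:
  assumes M: "module R M" and N: "module R N" and ds: "internal_direct_sum R M I A (carrier M)"
    and B: "\<And>j. j \<in> J \<Longrightarrow> submodule (B j) R N" and JI: "J \<subseteq> I"
  shows "internal_direct_sum R (tensor R M N) J (\<lambda>j. boxtimes R M N (A j) (B j))
    (sum_family (tensor R M N) J (\<lambda>j. boxtimes R M N (A j) (B j)))"
proof -
  interpret M: module R M by fact
  interpret N: module R N by fact
  let ?T = "tensor R M N"
  note T = tensor_module[OF M N]
  interpret T: module R ?T by (rule T)
  have A: "submodule (A j) R M" if "j \<in> J" for j
    using ds that JI unfolding internal_direct_sum_def by blast
  note AM = M.submoduleE(1)[OF A] and BN = N.submoduleE(1)[OF B]
  have box: "submodule (boxtimes R M N (A j) (B j)) R ?T" if "j \<in> J" for j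
    by (rule boxtimes_submodule[OF M N A[OF that] B[OF that]])
  have "a j = \<zero>\<^bsub>?T\<^esub>"
    if K: "finite K" "K \<subseteq> J" and a: "a \<in> (\<Pi> j\<in>K. boxtimes R M N (A j) (B j))"
      and z: "finsum ?T a K = \<zero>\<^bsub>?T\<^esub>" and j: "j \<in> K" for K a j
  proof -
    have jI: "j \<in> I" and jJ: "j \<in> J" using j K JI by auto
    obtain \<pi> where \<pi>: "\<pi> \<in> linear_hom R M M" "\<And>x. x \<in> A j \<Longrightarrow> \<pi> x = x"
      "\<And>k x. k \<in> I \<Longrightarrow> k \<noteq> j \<Longrightarrow> x \<in> A k \<Longrightarrow> \<pi> x = \<zero>\<^bsub>M\<^esub>"
      using internal_direct_sum_projection[OF M ds jI] by blast
    let ?h = "tensor_map R M N M N \<pi> (\<lambda>x. x)"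
    note h = tensor_map[OF M N M N \<pi>(1) linear_hom_id]
    have ac: "a k \<in> carrier ?T" if "k \<in> K" for k
      using a that K(2) T.submoduleE(1)[OF box] by blast
    \<comment> \<open>\<open>\<pi>\<close> is the identity on \<open>A j\<close>, so
      \<open>?h\<close> agrees with the identity on the pure tensors of the \<open>j\<close>-th
      summand.\<close>
    have hj: "?h (a j) = a j"
      by (rule boxtimes_linear_cong[OF M N T AM[OF jJ] BN[OF jJ] h(1) linear_hom_id])
         (use a j \<pi>(2) h(2) AM[OF jJ] BN[OF jJ] in \<open>auto simp: subset_iff\<close>)
    have hk: "?h (a k) = \<zero>\<^bsub>?T\<^esub>" if k: "k \<in> K" "k \<noteq> j" for k
    proof -
      have kJ: "k \<in> J" and kI: "k \<in> I" using k K JI by auto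
      show ?thesis
      proof (rule boxtimes_linear_cong[OF M N T AM[OF kJ] BN[OF kJ] h(1) linear_hom_zero[OF T T]])
        show "a k \<in> boxtimes R M N (A k) (B k)" using a k by auto
        fix m n assume mn: "m \<in> A k" "n \<in> B k"
        hence c: "m \<in> carrier M" "n \<in> carrier N" using AM[OF kJ] BN[OF kJ] by auto
        have "?h (pure_tensor R M N m n) = pure_tensor R M N \<zero>\<^bsub>M\<^esub> n"
          using h(2)[OF c] \<pi>(3)[OF kI k(2) mn(1)] by simp
        also have "\<dots> = \<zero>\<^bsub>?T\<^esub>"
          by (rule finsum_linear(2)[OF M T pure_tensor_linear(1)[OF M N c(2)], of "{}"]) auto
        finally show "?h (pure_tensor R M N m n) = \<zero>\<^bsub>?T\<^esub>" .
      qed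
    qed
    \<comment> \<open>Applying \<open>?h\<close> to the vanishing sum removes all terms but the
      \<open>j\<close>-th, which it keeps.\<close>
    have "\<zero>\<^bsub>?T\<^esub> = ?h (finsum ?T a K)"
      unfolding z by (rule finsum_linear(2)[OF T T h(1), of "{}", symmetric]) auto
    also have "\<dots> = finsum ?T (\<lambda>k. ?h (a k)) K"
      by (rule finsum_linear(1)[OF T T h(1) K(1)]) (use ac in auto)
    also have "\<dots> = finsum ?T (\<lambda>k. if j = k then a k else \<zero>\<^bsub>?T\<^esub>) K"
      by (rule T.M.finsum_cong') (use hj hk ac in auto)
    also have "\<dots> = a j"
      by (rule T.M.finsum_singleton) (use j K ac in auto)
    finally show ?thesis by simp
  qed
  thus ?thesis unfolding internal_direct_sum_def using box by blast
qed

subsection \<open>The reduced diagonal\<close>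

context color_coaugmented_coalgebra
begin

section \<open>The projection onto the coideal\<close>

abbreviation "F \<equiv> free_module R X"
abbreviation "Cbar \<equiv> coaug_coideal R C X \<epsilon>\<^sub>X"

definition coaug_projection where "coaug_projection c = c \<ominus>\<^bsub>C\<^esub> i\<^sub>X (\<epsilon>\<^sub>X c)"

lemma module_C: "module R C" by unfold_locales

lemma module_F: "module R F"
  by (rule free_module_module) (rule R.cring_axioms)

lemma color_counit_linear: "\<epsilon>\<^sub>X \<in> linear_hom R C F"
  using color_counit_coalgebra_hom by (simp add: coalgebra_hom_def)

lemma coaugmentation_linear: "i\<^sub>X \<in> linear_hom R F C"
  using coaugmentation_coalgebra_hom by (simp add: coalgebra_hom_def)

lemma mem_coaug_coideal: "c \<in> Cbar \<longleftrightarrow> c \<in> carrier C \<and> \<epsilon>\<^sub>X c = \<zero>\<^bsub>F\<^esub>"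
  by (simp add: coaug_coideal_def a_kernel_def')

lemma coaug_coideal_submodule: "submodule Cbar R C"
proof -
  have "Cbar = {c \<in> carrier C. \<epsilon>\<^sub>X c = \<zero>\<^bsub>F\<^esub>}" by (auto simp: mem_coaug_coideal)
  thus ?thesis using kernel_submodule[OF module_C module_F color_counit_linear] by simp
qed

lemma coaug_projection_linear: "coaug_projection \<in> linear_hom R C C"
proof -
  have "(\<lambda>c. c \<ominus>\<^bsub>C\<^esub> i\<^sub>X (\<epsilon>\<^sub>X c)) \<in> linear_hom R C C"
    by (intro linear_hom_minus[OF module_C module_C] linear_hom_id
        linear_hom_comp[OF color_counit_linear coaugmentation_linear])
  thus ?thesis by (simp add: coaug_projection_def[abs_def])
qed

text \<open>As \<open>\<epsilon>\<^sub>X (i\<^sub>X f) = f\<close>, the two terms cancel once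
  \<open>\<epsilon>\<^sub>X\<close> is applied. With the next two lemmas, p is a projection of C
  onto the coideal that kills the image of \<open>i\<^sub>X\<close>.\<close>

lemma coaug_projection_mem: "c \<in> carrier C \<Longrightarrow> coaug_projection c \<in> Cbar"
proof -
  note e = linear_homD[OF color_counit_linear] and i = linear_homD[OF coaugmentation_linear]
  assume c: "c \<in> carrier C"
  have "\<epsilon>\<^sub>X (coaug_projection c) = \<epsilon>\<^sub>X c \<ominus>\<^bsub>F\<^esub> \<epsilon>\<^sub>X (i\<^sub>X (\<epsilon>\<^sub>X c))"
    unfolding coaug_projection_def
    by (rule linear_minus[OF module_C module_F color_counit_linear]) (use c e i in auto)
  also have "\<dots> = \<zero>\<^bsub>F\<^esub>"
    using c e(1) by (simp add: color_counit_coaugmentation D.M.minus_eq D.M.r_neg)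
  finally show ?thesis
    using linear_homD(1)[OF coaug_projection_linear c] by (simp add: mem_coaug_coideal)
qed

lemma coaug_projection_coaugmentation:
  assumes f: "f \<in> carrier F"
  shows "coaug_projection (i\<^sub>X f) = \<zero>\<^bsub>C\<^esub>"
proof -
  show ?thesis using f linear_homD(1)[OF coaugmentation_linear f]
    by (simp add: coaug_projection_def color_counit_coaugmentation M.minus_eq M.r_neg)
qed

lemma coaug_projection_ident:
  assumes c: "c \<in> Cbar"
  shows "coaug_projection c = c"
proof -
  have "i\<^sub>X \<zero>\<^bsub>F\<^esub> = \<zero>\<^bsub>C\<^esub>"
    by (rule finsum_linear(2)[OF module_F module_C coaugmentation_linear, of "{}"]) auto
  thus ?thesis using c by (simp add: coaug_projection_def mem_coaug_coideal M.minus_eq)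
qed

text \<open>Expanding (id - e) \<otimes> (id - e) on \<Delta> c gives \<Delta> c, minus two mixed
  terms, plus the e \<otimes> e term. The mixed terms are the ones subtracted in the reduced
  diagonal, and the last one vanishes because \<open>\<epsilon>\<^sub>X c\<close> is zero.\<close>

lemma reduced_comult_eq:
  assumes c: "c \<in> Cbar"
  shows "reduced_comult R C \<Delta> X lco rco i\<^sub>X c
    = tensor_map R C C C C coaug_projection coaug_projection (\<Delta> c)"
proof -
  note C = module_C and F = module_F
  let ?T = "tensor R C C"
  note T = tensor_module[OF C C]
  interpret T: module R ?T by (rule T)
  let ?e = "\<lambda>c. i\<^sub>X (\<epsilon>\<^sub>X c)"
  let ?tm = "tensor_map R C C C C"
  note eps = color_counit_linear and i = coaugmentation_linear and id = linear_hom_id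
  note e = linear_hom_comp[OF eps i]
  have cC: "c \<in> carrier C" and c0: "\<epsilon>\<^sub>X c = \<zero>\<^bsub>F\<^esub>" using c by (auto simp: mem_coaug_coideal)
  have t: "\<Delta> c \<in> carrier ?T" by (rule linear_homD(1)[OF comult_linear cC])
  \<comment> \<open>e \<otimes> id is factored through \<open>F\<close> as (\<open>i\<^sub>X\<close>
    \<otimes> id) after (\<open>\<epsilon>\<^sub>X\<close> \<otimes> id); color counitality
    identifies the inner value at \<Delta> c with the coaction. The right side is symmetric.\<close>
  have left: "?tm ?e (\<lambda>c. c) (\<Delta> c) = tensor_map R F C C C i\<^sub>X (\<lambda>c. c) (lco c)"
    using tensor_map_comp[OF C C F C C C eps id i id t] color_counit_left[OF cC] by simp
  have right: "?tm (\<lambda>c. c) ?e (\<Delta> c) = tensor_map R C F C C (\<lambda>c. c) i\<^sub>X (rco c)"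
    using tensor_map_comp[OF C C C F C C id eps id i t] color_counit_right[OF cC] by simp
  have "?tm ?e ?e (\<Delta> c) = tensor_map R F F C C i\<^sub>X i\<^sub>X (tensor_map R C C F F \<epsilon>\<^sub>X \<epsilon>\<^sub>X (\<Delta> c))"
    using tensor_map_comp[OF C C F F C C eps eps i i t] by simp
  \<comment> \<open>\<open>\<epsilon>\<^sub>X\<close> is a coalgebra map, so this is the diagonal of
    zero: an empty sum, as the zero function has empty support.\<close>
  also have "tensor_map R C C F F \<epsilon>\<^sub>X \<epsilon>\<^sub>X (\<Delta> c) = grouplike_comult R X (\<epsilon>\<^sub>X c)"
    using color_counit_coalgebra_hom cC by (simp add: coalgebra_hom_def)
  also have "\<dots> = \<zero>\<^bsub>tensor R F F\<^esub>"
  proof -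
    interpret TF: module R "tensor R F F" by (rule tensor_module[OF F F])
    have "{x. \<zero>\<^bsub>F\<^esub> x \<noteq> \<zero>\<^bsub>R\<^esub>} = {}" by (simp add: free_module_def)
    thus ?thesis unfolding c0 grouplike_comult_def Let_def by simp
  qed
  also have "tensor_map R F F C C i\<^sub>X i\<^sub>X \<zero>\<^bsub>tensor R F F\<^esub> = \<zero>\<^bsub>?T\<^esub>"
    by (rule finsum_linear(2)[OF tensor_module[OF F F] T tensor_map(1)[OF F F C C i i], of "{}"]) auto
  finally have both: "?tm ?e ?e (\<Delta> c) = \<zero>\<^bsub>?T\<^esub>" .
  have p: "coaug_projection = (\<lambda>c. c \<ominus>\<^bsub>C\<^esub> ?e c)" by (rule ext) (simp add: coaug_projection_def)
  note pl = coaug_projection_linear[unfolded p]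
  have cl: "?tm ?e (\<lambda>c. c) (\<Delta> c) \<in> carrier ?T" "?tm (\<lambda>c. c) ?e (\<Delta> c) \<in> carrier ?T"
    by (intro linear_homD(1)[OF tensor_map(1)] C e id t)+
  have "?tm coaug_projection coaug_projection (\<Delta> c)
    = ?tm (\<lambda>c. c) coaug_projection (\<Delta> c) \<ominus>\<^bsub>?T\<^esub> ?tm ?e coaug_projection (\<Delta> c)"
    unfolding p by (rule tensor_map_minus_left[OF C C C C id e pl t])
  also have "?tm (\<lambda>c. c) coaug_projection (\<Delta> c) = \<Delta> c \<ominus>\<^bsub>?T\<^esub> ?tm (\<lambda>c. c) ?e (\<Delta> c)"
    unfolding p tensor_map_minus_right[OF C C C C id id e t] tensor_map_id[OF C C t] ..
  \<comment> \<open>e \<otimes> p differs from e \<otimes> id by e \<otimes> e, which vanishes at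
    \<Delta> c.\<close>
  also have "?tm ?e coaug_projection (\<Delta> c) = ?tm ?e (\<lambda>c. c) (\<Delta> c)"
    unfolding p tensor_map_minus_right[OF C C C C e id e t] both
    using cl by (simp add: T.M.minus_eq)
  \<comment> \<open>The definition subtracts the left coaction term first, the computation the right
    one; commutativity reconciles them.\<close>
  finally show ?thesis unfolding reduced_comult_def left[symmetric] right[symmetric]
    using t cl by (simp add: T.M.minus_eq T.M.a_ac)
qed

text \<open>Every element of C \<otimes> C is a finite sum of pure tensors and p maps all of C into
  the coideal, so the form (p \<otimes> p) \<Delta> c of the reduced diagonal gives the
  membership.\<close>

lemma reduced_comult_mem:
  assumes c: "c \<in> Cbar"
  shows "reduced_comult R C \<Delta> X lco rco i\<^sub>X c \<in> boxtimes R C C Cbar Cbar"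
proof -
  note C = module_C and p = coaug_projection_linear and sub = coaug_coideal_submodule
  have cC: "c \<in> carrier C" using c by (simp add: mem_coaug_coideal)
  have t: "\<Delta> c \<in> boxtimes R C C (carrier C) (carrier C)"
    unfolding boxtimes_carrier[OF C C] by (rule linear_homD(1)[OF comult_linear cC])
  show ?thesis unfolding reduced_comult_eq[OF c]
    by (rule tensor_map_boxtimes[OF C C C C p p _ _ sub sub _ _ t]) (auto intro: coaug_projection_mem)
qed

text \<open>On a color component both coactions are pure tensors, so the terms subtracted in the
  reduced diagonal become x \<otimes> c and c \<otimes> y; its definition is then solved for
  \<Delta> c.\<close>

lemma comult_decomposition:
  assumes x: "x \<in> X" and y: "y \<in> X" and c: "c \<in> coaug_component R C X lco rco \<epsilon>\<^sub>X x y"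
  shows "\<Delta> c = pure_tensor R C C (i\<^sub>X (basis_elem R x)) c
      \<oplus>\<^bsub>tensor R C C\<^esub> pure_tensor R C C c (i\<^sub>X (basis_elem R y))
      \<oplus>\<^bsub>tensor R C C\<^esub> reduced_comult R C \<Delta> X lco rco i\<^sub>X c"
proof -
  note C = module_C and F = module_F
  interpret T: module R "tensor R C C" by (rule tensor_module[OF C C])
  note id = linear_hom_id and i = coaugmentation_linear
  have b: "basis_elem R z \<in> carrier F" if "z \<in> X" for z
    using that by (rule basis_elem_closed[OF R.cring_axioms])
  have cC: "c \<in> carrier C" and lr: "lco c = pure_tensor R F C (basis_elem R x) c"
    "rco c = pure_tensor R C F c (basis_elem R y)"
    using c by (auto simp: coaug_component_def color_component_def)
  have "\<Delta> c \<in> carrier (tensor R C C)" by (rule linear_homD(1)[OF comult_linear cC])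
  moreover have "pure_tensor R C C (i\<^sub>X (basis_elem R x)) c \<in> carrier (tensor R C C)"
    "pure_tensor R C C c (i\<^sub>X (basis_elem R y)) \<in> carrier (tensor R C C)"
    using linear_homD(1)[OF i b] x y cC by (auto intro!: pure_tensor_bilinear(1)[OF C C])
  moreover have "reduced_comult R C \<Delta> X lco rco i\<^sub>X c
      = (\<Delta> c \<ominus>\<^bsub>tensor R C C\<^esub> pure_tensor R C C (i\<^sub>X (basis_elem R x)) c)
        \<ominus>\<^bsub>tensor R C C\<^esub> pure_tensor R C C c (i\<^sub>X (basis_elem R y))"
    unfolding reduced_comult_def lr
    by (simp add: tensor_map(2)[OF F C C C i id b[OF x] cC] tensor_map(2)[OF C F C C id i cC b[OF y]])
  ultimately show ?thesis
    by (simp add: T.M.minus_eq T.M.a_ac T.M.r_neg1 T.M.r_neg2 T.M.r_neg)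
qed

end

section \<open>The grading inherited by the coideal\<close>

context graded_color_coaugmented_coalgebra
begin

lemma graded_submodule: "submodule (Cg n) R C"
  using grading by (simp add: internal_direct_sum_def)

text \<open>\<open>\<epsilon>\<^sub>X\<close> vanishes in positive degrees, so the components of
  positive degree lie in the coideal; the component of degree 0 is what remains of c after
  subtracting them. Independence is inherited from C.\<close>

lemma coaug_coideal_graded:
  "internal_direct_sum R C UNIV (\<lambda>n. Cbar \<inter> Cg n) Cbar"
proof -
  note C = module_C and sub = coaug_coideal_submodule
  have CgC: "Cg n \<subseteq> carrier C" for n by (rule submoduleE(1)[OF graded_submodule])
  have pos: "c \<in> Cbar" if "c \<in> Cg n" "0 < n" for c n
    using color_counit_graded[OF that(2,1)] that CgC by (auto simp: mem_coaug_coideal)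
  have "c \<in> sum_family C UNIV (\<lambda>n. Cbar \<inter> Cg n)" if c: "c \<in> Cbar" for c
  proof -
    have "c \<in> sum_family C UNIV Cg"
      using c grading by (simp add: internal_direct_sum_def mem_coaug_coideal)
    then obtain J a where J: "finite J" "a \<in> (\<Pi> j\<in>J. Cg j)" "c = finsum C a J"
      unfolding sum_family_def by blast
    have aC: "a j \<in> carrier C" if "j \<in> J" for j using that J(2) CgC by blast
    have "a j \<in> Cbar" if j: "j \<in> J" for j
    proof (cases "j = 0")
      case False thus ?thesis using pos J(2) j by blast
    next
      case True
      let ?s = "finsum C a (J - {0})"
      have s: "?s \<in> Cbar"
        by (rule submodule_finsum_closed[OF C sub]) (use J pos in auto)
      hence sC: "?s \<in> carrier C" by (simp add: mem_coaug_coideal)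
      have "c = finsum C a (insert 0 (J - {0}))"
        using j True J(3) by (simp add: insert_absorb)
      also have "\<dots> = a 0 \<oplus>\<^bsub>C\<^esub> ?s"
        by (rule M.finsum_insert) (use J(1) aC j True in auto)
      finally have "a 0 = c \<oplus>\<^bsub>C\<^esub> (\<ominus>\<^bsub>C\<^esub> ?s)"
        using aC j True sC by (simp add: M.a_assoc M.r_neg)
      thus ?thesis using True c s submoduleE(3,5)[OF sub] by simp
    qed
    thus ?thesis unfolding sum_family_def using J by blast
  qed
  moreover have "sum_family C UNIV (\<lambda>n. Cbar \<inter> Cg n) \<subseteq> Cbar"
    unfolding sum_family_def by (auto intro!: submodule_finsum_closed[OF C sub])
  moreover have "\<forall>j\<in>J. a j = \<zero>\<^bsub>C\<^esub>"
    if "finite J" "a \<in> (\<Pi> j\<in>J. Cbar \<inter> Cg j)" "finsum C a J = \<zero>\<^bsub>C\<^esub>" for J a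
  proof -
    have "a \<in> (\<Pi> j\<in>J. Cg j)" using that(2) by auto
    thus ?thesis using grading that(1,3) by (auto simp: internal_direct_sum_def)
  qed
  ultimately show ?thesis
    unfolding internal_direct_sum_def using submodule_inter[OF C sub graded_submodule] by blast
qed

end

section \<open>Degrees of the reduced diagonal in the color reduced case\<close>

context color_reduced_coalgebra
begin

text \<open>p \<otimes> p is applied to a homogeneous decomposition of \<Delta> c. Reducedness
  enters through \<open>p0\<close>: degree 0 is the image of \<open>i\<^sub>X\<close>, which p
  kills. For \<open>n = 0\<close> the range \<open>{1..n - 1}\<close> is empty and the value is
  zero.\<close>

lemma reduced_comult_graded:
  assumes c: "c \<in> Cbar" "c \<in> Cg n"
  shows "reduced_comult R C \<Delta> X lco rco i\<^sub>X c
    \<in> sum_family (tensor R C C) {1..n - 1} (\<lambda>i. boxtimes R C C (Cg i) (Cg (n - i)))"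
proof -
  note C = module_C and p = coaug_projection_linear
  let ?T = "tensor R C C"
  let ?h = "tensor_map R C C C C coaug_projection coaug_projection"
  note T = tensor_module[OF C C]
  interpret T: module R ?T by (rule T)
  note h = tensor_map[OF C C C C p p]
  note sub = graded_submodule
  have CgC: "Cg k \<subseteq> carrier C" for k by (rule submoduleE(1)[OF sub])
  have pC: "coaug_projection z \<in> carrier C" if "z \<in> Cg k" for z k
    using that CgC linear_homD(1)[OF p] by blast
  have p0: "coaug_projection z = \<zero>\<^bsub>C\<^esub>" if "z \<in> Cg 0" for z
    using that coaug_projection_coaugmentation by (auto simp: color_reduced)
  have pk: "coaug_projection z = z" if "z \<in> Cg k" "0 < k" for z k
    using that CgC color_counit_graded by (intro coaug_projection_ident) (auto simp: mem_coaug_coideal)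
  \<comment> \<open>p is zero in degree 0 and the identity above, so p \<otimes> p leaves each term
    of \<Delta> c in its own summand.\<close>
  have pg: "coaug_projection ` Cg k \<subseteq> Cg k" for k
    by (cases "k = 0") (use p0 pk submodule_zero_closed[OF sub] in auto)
  have pure0: "pure_tensor R C C \<zero>\<^bsub>C\<^esub> z = \<zero>\<^bsub>?T\<^esub>" "pure_tensor R C C z \<zero>\<^bsub>C\<^esub> = \<zero>\<^bsub>?T\<^esub>"
    if z: "z \<in> carrier C" for z
    by (rule finsum_linear(2)[OF C T pure_tensor_linear(1)[OF C C z], of "{}"], simp, simp)
       (rule finsum_linear(2)[OF C T pure_tensor_linear(2)[OF C C z], of "{}"], simp, simp)
  obtain J a where J: "finite J" "J \<subseteq> {0..n}" "a \<in> (\<Pi> j\<in>J. boxtimes R C C (Cg j) (Cg (n - j)))"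
    "\<Delta> c = finsum ?T a J"
    using comult_graded[OF c(2)] unfolding sum_family_def by blast
  have aT: "a j \<in> carrier ?T" if "j \<in> J" for j
    using J(3) that T.submoduleE(1)[OF boxtimes_submodule[OF C C sub sub]] by blast
  have hg: "?h (a j) \<in> boxtimes R C C (Cg j) (Cg (n - j))" if "j \<in> J" for j
    by (rule tensor_map_boxtimes[OF C C C C p p CgC CgC sub sub pg pg]) (use J(3) that in auto)
  \<comment> \<open>Subtraction is truncated, but \<open>J\<close> lies in \<open>{0..n}\<close>, so
    \<open>n - j = 0\<close> means \<open>j = n\<close>. One factor then has degree 0 and is killed
    by p.\<close>
  have hz: "?h (a j) = \<zero>\<^bsub>?T\<^esub>" if j: "j \<in> J" "j = 0 \<or> n - j = 0" for j
  proof (rule boxtimes_linear_cong[OF C C T CgC CgC h(1) linear_hom_zero[OF T T]])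
    show "a j \<in> boxtimes R C C (Cg j) (Cg (n - j))" using J(3) j by auto
    fix u v assume uv: "u \<in> Cg j" "v \<in> Cg (n - j)"
    hence "u \<in> carrier C" "v \<in> carrier C" using CgC by blast+
    from h(2)[OF this] show "?h (pure_tensor R C C u v) = \<zero>\<^bsub>?T\<^esub>"
      using uv j(2) p0 pC pure0 by auto
  qed
  have "reduced_comult R C \<Delta> X lco rco i\<^sub>X c = ?h (finsum ?T a J)"
    unfolding reduced_comult_eq[OF c(1)] J(4) ..
  also have "\<dots> = finsum ?T (\<lambda>j. ?h (a j)) J"
    by (rule finsum_linear(1)[OF T T h(1) J(1)]) (use aT in auto)
  also have "\<dots> = finsum ?T (\<lambda>j. ?h (a j)) (J \<inter> {1..n - 1})"
  proof (rule T.M.add.finprod_mono_neutral_cong_right)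
    \<comment> \<open>An index of \<open>J\<close> outside \<open>{1..n - 1}\<close> is 0 or
      \<open>n\<close>.\<close>
    show "?h (a j) = \<zero>\<^bsub>?T\<^esub>" if "j \<in> J - J \<inter> {1..n - 1}" for j
      using that J(2) by (intro hz) auto
  qed (use J(1) aT linear_homD(1)[OF h(1)] in auto)
  finally have eq: "reduced_comult R C \<Delta> X lco rco i\<^sub>X c = \<dots>" .
  show ?thesis unfolding sum_family_def eq
    by (intro CollectI exI[of _ "J \<inter> {1..n - 1}"] exI[of _ "\<lambda>j. ?h (a j)"])
       (use J(1) hg in auto)
qed

end

section \<open>The decomposition of the diagonal and its graded refinement\<close>

theorem theorem2p18:
  fixes R :: "('r, 'e) ring_scheme" and C :: "('r, 'c, 'm) module_scheme"
    and \<Delta> :: "'c \<Rightarrow> ('c \<times> 'c \<Rightarrow> 'r) set" and \<epsilon> :: "'c \<Rightarrow> 'r"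
    and X :: "'x set"
    and lco :: "'c \<Rightarrow> (('x \<Rightarrow> 'r) \<times> 'c \<Rightarrow> 'r) set"
    and rco :: "'c \<Rightarrow> ('c \<times> ('x \<Rightarrow> 'r) \<Rightarrow> 'r) set"
    and \<epsilon>\<^sub>X :: "'c \<Rightarrow> 'x \<Rightarrow> 'r" and i\<^sub>X :: "('x \<Rightarrow> 'r) \<Rightarrow> 'c"
  assumes "color_coaugmented_coalgebra R C \<Delta> \<epsilon> X lco rco \<epsilon>\<^sub>X i\<^sub>X"
  shows
    "(\<forall>x\<in>X. \<forall>y\<in>X. \<forall>c\<in>coaug_component R C X lco rco \<epsilon>\<^sub>X x y.
        \<exists>w\<in>boxtimes R C C (coaug_coideal R C X \<epsilon>\<^sub>X) (coaug_coideal R C X \<epsilon>\<^sub>X).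
          \<Delta> c = pure_tensor R C C (i\<^sub>X (basis_elem R x)) c
                  \<oplus>\<^bsub>tensor R C C\<^esub> pure_tensor R C C c (i\<^sub>X (basis_elem R y))
                  \<oplus>\<^bsub>tensor R C C\<^esub> w \<and>
          w = reduced_comult R C \<Delta> X lco rco i\<^sub>X c) \<and>
     (\<forall>Cg :: nat \<Rightarrow> 'c set.
        color_reduced_coalgebra R C \<Delta> \<epsilon> X lco rco \<epsilon>\<^sub>X i\<^sub>X Cg \<longrightarrow>
        internal_direct_sum R C UNIV (\<lambda>n. coaug_coideal R C X \<epsilon>\<^sub>X \<inter> Cg n) (coaug_coideal R C X \<epsilon>\<^sub>X) \<and>
        (\<forall>n>0. \<forall>c\<in>coaug_coideal R C X \<epsilon>\<^sub>X \<inter> Cg n.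
           \<exists>S. internal_direct_sum R (tensor R C C) {1..n - 1}
                 (\<lambda>i. boxtimes R C C (Cg i) (Cg (n - i))) S \<and>
               reduced_comult R C \<Delta> X lco rco i\<^sub>X c \<in> S))"
proof -
  interpret color_coaugmented_coalgebra R C \<Delta> \<epsilon> X lco rco \<epsilon>\<^sub>X i\<^sub>X by fact
  have "\<exists>S. internal_direct_sum R (tensor R C C) {1..n - 1} (\<lambda>i. boxtimes R C C (Cg i) (Cg (n - i))) S \<and>
      reduced_comult R C \<Delta> X lco rco i\<^sub>X c \<in> S"
    if "color_reduced_coalgebra R C \<Delta> \<epsilon> X lco rco \<epsilon>\<^sub>X i\<^sub>X Cg"
      and c: "c \<in> Cbar \<inter> Cg n" for Cg n c
  proof -
    interpret red: color_reduced_coalgebra R C \<Delta> \<epsilon> X lco rco \<epsilon>\<^sub>X i\<^sub>X Cg by fact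
    \<comment> \<open>The witness \<open>S\<close> is the \<open>sum_family\<close> over
      \<open>{1..n - 1}\<close>, the only set that \<open>internal_direct_sum\<close> admits here;
      it is direct because the grading of the left factor separates the summands.\<close>
    show ?thesis
      using internal_direct_sum_boxtimes[OF module_C module_C red.grading red.graded_submodule subset_UNIV]
        red.reduced_comult_graded c by blast
  qed
  moreover have "internal_direct_sum R C UNIV (\<lambda>n. Cbar \<inter> Cg n) Cbar"
    if "color_reduced_coalgebra R C \<Delta> \<epsilon> X lco rco \<epsilon>\<^sub>X i\<^sub>X Cg" for Cg
  proof -
    interpret red: color_reduced_coalgebra R C \<Delta> \<epsilon> X lco rco \<epsilon>\<^sub>X i\<^sub>X Cg by fact
    show ?thesis by (rule red.coaug_coideal_graded)
  qed
  moreover have "\<exists>w\<in>boxtimes R C C Cbar Cbar.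
      \<Delta> c = pure_tensor R C C (i\<^sub>X (basis_elem R x)) c
        \<oplus>\<^bsub>tensor R C C\<^esub> pure_tensor R C C c (i\<^sub>X (basis_elem R y)) \<oplus>\<^bsub>tensor R C C\<^esub> w \<and>
      w = reduced_comult R C \<Delta> X lco rco i\<^sub>X c"
    if "x \<in> X" "y \<in> X" and c: "c \<in> coaug_component R C X lco rco \<epsilon>\<^sub>X x y" for x y c
  proof -
    have "c \<in> Cbar" using c by (simp add: coaug_component_def)
    thus ?thesis using comult_decomposition[OF that] reduced_comult_mem by blast
  qed
  ultimately show ?thesis by blast
qed

end
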